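(* Let $(\Omega,\mathcal F,(\mathcal F_t)_{t\in\mathbb R_+})$ be a filtered space with right-continuous filtration and $\mathcal F=\bigvee_t\mathcal F_t$. Let $\mu,\nu$ and $P$ be probability measures on it such that $\mu\stackrel{loc}{\ll}P$ and $\nu\stackrel{loc}{\ll}P$, and let $z$ and $z'$ be the density processes of $\mu$ and $\nu$ with respect to $P$, respectively. If $T$ is a stopping time, then $$\|(\mu_{T-})_a\|=\liminf_{n\to\infty,\ \alpha\to1-0}\Big\{\int z_0^{\alpha}(z'_0)^{1-\alpha}1_{\{T=0\}}\,dP_0+\int z_n^{\alpha}(z'_n)^{1-\alpha}1_{\{n<T\}}\,dP_n$$ $$+\sum_{k=1}^{n2^n}\int\Big[\mathbf E_P\big[z_{\frac{k}{2^n}}1_{\{\frac{k-1}{2^n}<T\le\frac{k}{2^n}\}}\,\big|\,\mathcal F_{\frac{k-1}{2^n}}\big]\Big]^{\alpha}\Big[\mathbf E_P\big[z'_{\frac{k}{2^n}}1_{\{\frac{k-1}{2^n}<T\le\frac{k}{2^n}\}}\,\big|\,\mathcal F_{\frac{k-1}{2^n}}\big]\Big]^{1-\alpha}dP_{\frac{k-1}{2^n}}\Big\},$$ where $(\mu_{T-})_a$ is the absolutely continuous part of $\mu_{T-}$ with respect to $\nu_{T-}$.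
   Context: Stopping times take values in $[0,\infty]$. $\mathcal F_{T-}$ is the $\sigma$-algebra generated by $\mathcal F_0$ and the sets $A\cap\{t<T\}$, $A\in\mathcal F_t$, $t\ge0$; $\mu_{T-},\nu_{T-}$ are the restrictions of $\mu,\nu$ to $\mathcal F_{T-}$. $P_t$ (and similarly $\mu_t,\nu_t$) is the restriction to $\mathcal F_t$. $\mu\stackrel{loc}{\ll}P$ means $\mu_t\ll P_t$ for all $t$. The density processes are $z_t=d\mu_t/dP_t$, $z'_t=d\nu_t/dP_t$, taken right-continuous with left limits. $\|\cdot\|$ is the total variation norm. The double lower limit is defined by $$\liminf_{n\to\infty,\ \alpha\to1-0}f(\alpha,n)=\sup_{n\in\mathbb N,\ \beta\in(0,1)}\ \inf_{m\ge n,\ x\in[\beta,1)}f(x,m).$$ *)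

theory Defs
  imports "HOL-Probability.Probability"
begin

section \<open>Filtered spaces and stopping times\<close>

text \<open>The measurable space \<open>(\<Omega>, \<F>)\<close> is given by \<open>space M\<close> and \<open>sets M\<close>; the measures carried by
  \<open>M\<close> and by the \<open>F t\<close> play no role. Time is \<open>[0, \<infinity>)\<close>, so \<open>F t\<close> is unconstrained for \<open>t < 0\<close>.\<close>

definition filtered_space :: "'a measure \<Rightarrow> (real \<Rightarrow> 'a measure) \<Rightarrow> bool" where
  "filtered_space M F \<longleftrightarrow>
     (\<forall>t\<ge>0. subalgebra M (F t)) \<and>
     (\<forall>s t. 0 \<le> s \<and> s \<le> t \<longrightarrow> sets (F s) \<subseteq> sets (F t))"

definition right_continuous_filtration :: "(real \<Rightarrow> 'a measure) \<Rightarrow> bool" where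
  "right_continuous_filtration F \<longleftrightarrow> (\<forall>t\<ge>0. sets (F t) = (\<Inter>s\<in>{t<..}. sets (F s)))"

definition generated_by_filtration :: "'a measure \<Rightarrow> (real \<Rightarrow> 'a measure) \<Rightarrow> bool" where
  "generated_by_filtration M F \<longleftrightarrow> sets M = sigma_sets (space M) (\<Union>t\<in>{0..}. sets (F t))"

text \<open>The library's \<open>stopping_time\<close> forces the time index and the values of \<open>T\<close> to have the same
  type; here \<open>T\<close> may take the value \<open>\<infinity>\<close> while the filtration is indexed by finite times.\<close>

definition ext_stopping_time :: "(real \<Rightarrow> 'a measure) \<Rightarrow> ('a \<Rightarrow> ennreal) \<Rightarrow> bool" where
  "ext_stopping_time F T \<longleftrightarrow> (\<forall>t\<ge>0. Measurable.pred (F t) (\<lambda>\<omega>. T \<omega> \<le> ennreal t))"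

definition strict_past :: "'a measure \<Rightarrow> (real \<Rightarrow> 'a measure) \<Rightarrow> ('a \<Rightarrow> ennreal) \<Rightarrow> 'a measure" where
  "strict_past M F T =
     sigma (space M) (sets (F 0) \<union> {A \<inter> {\<omega> \<in> space M. ennreal t < T \<omega>} | A t. 0 \<le> t \<and> A \<in> sets (F t)})"

section \<open>Local absolute continuity and density processes\<close>

definition locally_absolutely_continuous ::
    "(real \<Rightarrow> 'a measure) \<Rightarrow> 'a measure \<Rightarrow> 'a measure \<Rightarrow> bool" where
  "locally_absolutely_continuous F P \<mu> \<longleftrightarrow>
     (\<forall>t\<ge>0. absolutely_continuous (restr_to_subalg P (F t)) (restr_to_subalg \<mu> (F t)))"

definition cadlag :: "(real \<Rightarrow> real) \<Rightarrow> bool" where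
  "cadlag x \<longleftrightarrow> (\<forall>t\<ge>0. (x \<longlongrightarrow> x t) (at_right t)) \<and> (\<forall>t>0. \<exists>l. (x \<longlongrightarrow> l) (at_left t))"

text \<open>Path regularity is required \<open>P\<close>-almost surely: the filtration is not assumed complete, so an
  adapted version all of whose paths are regular need not exist.\<close>

definition density_process ::
    "(real \<Rightarrow> 'a measure) \<Rightarrow> 'a measure \<Rightarrow> 'a measure \<Rightarrow> (real \<Rightarrow> 'a \<Rightarrow> real) \<Rightarrow> bool" where
  "density_process F P \<mu> z \<longleftrightarrow>
     (\<forall>t\<ge>0. z t \<in> borel_measurable (F t) \<and> (\<forall>\<omega>\<in>space P. 0 \<le> z t \<omega>) \<and>
        restr_to_subalg \<mu> (F t) = density (restr_to_subalg P (F t)) (\<lambda>\<omega>. ennreal (z t \<omega>))) \<and>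
     (AE \<omega> in P. cadlag (\<lambda>t. z t \<omega>))"

section \<open>Lebesgue decomposition\<close>

definition mutually_singular :: "'a measure \<Rightarrow> 'a measure \<Rightarrow> bool" where
  "mutually_singular N M \<longleftrightarrow> (\<exists>Z\<in>null_sets N. space M - Z \<in> null_sets M)"

definition lebesgue_decomposition ::
    "'a measure \<Rightarrow> 'a measure \<Rightarrow> 'a measure \<Rightarrow> 'a measure \<Rightarrow> bool" where
  "lebesgue_decomposition N M A S \<longleftrightarrow>
     sets A = sets M \<and> sets S = sets M \<and>
     (\<forall>X\<in>sets M. emeasure M X = emeasure A X + emeasure S X) \<and>
     absolutely_continuous N A \<and> mutually_singular N S"

definition ac_part :: "'a measure \<Rightarrow> 'a measure \<Rightarrow> 'a measure" where
  "ac_part N M = (THE A. \<exists>S. lebesgue_decomposition N M A S)"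

lemma lebesgue_decomposition_exists:
  assumes "finite_measure M" and sets_eq: "sets N = sets M"
  shows "\<exists>A S. lebesgue_decomposition N M A S"
proof -
  interpret finite_measure M by fact
  have sp: "space N = space M" using sets_eq by (rule sets_eq_imp_space_eq)
  define c where "c = (SUP Z\<in>null_sets N. emeasure M Z)"
  have "\<exists>f::nat \<Rightarrow> 'a set. range f \<subseteq> null_sets N \<and> c = (SUP i. emeasure M (f i))"
  proof -
    have "emeasure M ` null_sets N \<noteq> {}" by auto
    from ennreal_SUP_countable_SUP[OF _, of "null_sets N" "emeasure M"]
    obtain g :: "nat \<Rightarrow> ennreal" where g: "range g \<subseteq> emeasure M ` null_sets N" "c = (SUP i. g i)"
      unfolding c_def by auto
    then have "\<forall>i. \<exists>Z\<in>null_sets N. g i = emeasure M Z" by auto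
    then obtain f where "\<And>i. f i \<in> null_sets N \<and> g i = emeasure M (f i)" by metis
    then show ?thesis using g by (intro exI[of _ f]) auto
  qed
  then obtain f :: "nat \<Rightarrow> 'a set" where f: "range f \<subseteq> null_sets N" "c = (SUP i. emeasure M (f i))"
    by blast
  define Z where "Z = (\<Union>i. f i)"
  have ZN: "Z \<in> null_sets N" unfolding Z_def using f by auto
  have ZM [measurable]: "Z \<in> sets M" using ZN sets_eq by auto
  have max: "emeasure M W \<le> emeasure M Z" if "W \<in> null_sets N" for W
  proof -
    have "emeasure M W \<le> c" unfolding c_def using that by (rule SUP_upper)
    also have "c \<le> emeasure M Z"
      unfolding f by (intro SUP_least emeasure_mono) (use ZM in \<open>auto simp: Z_def\<close>)
    finally show ?thesis .
  qed
  define A where "A = density M (indicator (space M - Z))"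
  define S where "S = density M (indicator Z)"
  have A: "emeasure A X = emeasure M (X - Z)" if "X \<in> sets M" for X
  proof -
    have "(space M - Z) \<inter> X = X - Z" using sets.sets_into_space[OF that] by auto
    then show ?thesis unfolding A_def using that by (simp add: emeasure_restricted)
  qed
  have S: "emeasure S X = emeasure M (X \<inter> Z)" if "X \<in> sets M" for X
    unfolding S_def using that by (simp add: emeasure_restricted Int_commute)
  have "absolutely_continuous N A"
    unfolding absolutely_continuous_def
  proof
    fix X assume X: "X \<in> null_sets N"
    then have XM: "X \<in> sets M" using sets_eq by auto
    have "emeasure M Z + emeasure M (X - Z) = emeasure M (Z \<union> X)"
      using XM by (subst plus_emeasure) auto
    also have "\<dots> \<le> emeasure M Z" using ZN X by (intro max) auto
    finally have "emeasure M (X - Z) = 0"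
      using emeasure_finite[of Z] by (metis add.right_neutral ennreal_add_left_cancel_le infinity_ennreal_def le_zero_eq)
    then show "X \<in> null_sets A"
      using XM A[OF XM] by (intro null_setsI) (auto simp: A_def)
  qed
  moreover have "mutually_singular N S"
    unfolding mutually_singular_def
  proof (intro bexI[of _ Z] null_setsI)
    show "emeasure S (space S - Z) = 0"
      using S[of "space M - Z"] by (simp add: S_def Diff_Int_distrib2)
  qed (use ZN in \<open>auto simp: S_def\<close>)
  moreover have "emeasure M X = emeasure A X + emeasure S X" if "X \<in> sets M" for X
  proof -
    have "(X - Z) \<inter> (X \<inter> Z) = {}" by blast
    with that plus_emeasure[of "X - Z" M "X \<inter> Z"] show ?thesis by (simp add: A S Un_Diff_Int)
  qed
  ultimately have "lebesgue_decomposition N M A S"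
    unfolding lebesgue_decomposition_def by (auto simp: A_def S_def)
  then show ?thesis by blast
qed

lemma lebesgue_decomposition_unique:
  assumes "lebesgue_decomposition N M A S" "lebesgue_decomposition N M A' S'"
    and sets_eq: "sets N = sets M"
  shows "A = A'"
proof (rule measure_eqI)
  show "sets A = sets A'" using assms by (simp add: lebesgue_decomposition_def)
next
  fix X assume "X \<in> sets A"
  then have X: "X \<in> sets M" using assms by (simp add: lebesgue_decomposition_def)
  obtain Z where Z: "Z \<in> null_sets N" "space S - Z \<in> null_sets S"
    using assms by (auto simp: lebesgue_decomposition_def mutually_singular_def)
  obtain Z' where Z': "Z' \<in> null_sets N" "space S' - Z' \<in> null_sets S'"
    using assms by (auto simp: lebesgue_decomposition_def mutually_singular_def)
  define W where "W = Z \<union> Z'"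
  have W: "W \<in> null_sets N" unfolding W_def using Z Z' by auto
  then have WM: "W \<in> sets M" using sets_eq by auto
  have *: "emeasure B X = emeasure M (X - W)"
    if B: "lebesgue_decomposition N M B R" and V: "V \<subseteq> W" "space R - V \<in> null_sets R" for B R V
  proof -
    have sR: "sets R = sets M" and sB: "sets B = sets M" and ac: "absolutely_continuous N B"
      using B by (auto simp: lebesgue_decomposition_def)
    have "W \<in> null_sets B" using ac W by (auto simp: absolutely_continuous_def)
    then have "emeasure B X = emeasure B (X - W)"
      using X sB by (simp add: emeasure_Diff_null_set)
    moreover have "X - W \<subseteq> space R - V"
      using sets.sets_into_space[OF X] V sets_eq_imp_space_eq[OF sR] by auto
    then have "emeasure R (X - W) = 0"
      using V(2) X WM sR by (intro null_setsD1 null_sets_subset[OF V(2)]) auto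
    ultimately show ?thesis
      using B X WM by (auto simp: lebesgue_decomposition_def)
  qed
  show "emeasure A X = emeasure A' X"
    using *[OF assms(1) _ Z(2)] *[OF assms(2) _ Z'(2)] by (auto simp: W_def)
qed

lemma lebesgue_decomposition_ac_part:
  assumes "finite_measure M" "sets N = sets M"
  shows "\<exists>S. lebesgue_decomposition N M (ac_part N M) S"
  unfolding ac_part_def
  by (rule theI') (use lebesgue_decomposition_exists[OF assms]
    lebesgue_decomposition_unique[OF _ _ assms(2)] in blast)

section \<open>Total variation norm and double lower limit\<close>

text \<open>\<open>\<phi>\<close> is a finite signed measure on \<open>sets M\<close>.\<close>

definition total_variation_norm :: "'a measure \<Rightarrow> ('a set \<Rightarrow> real) \<Rightarrow> ereal" where
  "total_variation_norm M \<phi> =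
     (SUP C\<in>{C. finite C \<and> disjoint C \<and> C \<subseteq> sets M \<and> \<Union>C = space M}. ereal (\<Sum>A\<in>C. \<bar>\<phi> A\<bar>))"

definition double_liminf :: "(real \<Rightarrow> nat \<Rightarrow> ereal) \<Rightarrow> ereal" where
  "double_liminf f =
     (SUP (n, \<beta>)\<in>UNIV \<times> {0<..<1}. INF (m, x)\<in>{n..} \<times> {\<beta>..<1}. f x m)"

end

theory Submission
  imports Defs
begin

text \<open>The \<open>n\<close>-th sum is the Hellinger integral of order \<open>\<alpha>\<close> of \<open>\<mu>\<close> and \<open>\<nu>\<close> restricted to the
  \<open>\<sigma>\<close>-algebra \<open>\<G>\<^sub>n\<close> of the sets that agree, on each dyadic cell \<open>(k - 1) / 2\<^sup>n < T \<le> k / 2\<^sup>n\<close>, with a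
  set of \<open>F ((k - 1) / 2\<^sup>n)\<close>; the \<open>\<G>\<^sub>n\<close> increase and generate \<open>\<F>\<^bsub>T-\<^esub>\<close>.

  Upper bound: let \<open>Z\<close> be a \<open>\<nu>\<close>-null set carrying the singular part of \<open>\<mu>\<close>. Approximate \<open>Z\<close> by
  \<open>B \<in> \<G>\<^sub>n\<close> up to \<open>d\<close> and bound the integrand \<open>a\<^sup>\<alpha> b\<^bsup>1-\<alpha>\<^esup>\<close> by \<open>d\<^bsup>1-\<alpha>\<^esup> (a + b / d)\<close> on \<open>B\<close> and by
  \<open>a + (1 - \<alpha>) b\<close> off \<open>B\<close>. These bounds are linear in \<open>(a, b)\<close>, so they integrate and sum over the cells;
  then let \<open>d\<close> be small depending on \<open>\<alpha>\<close>.

  Lower bound: restricting \<open>\<mu>\<^sub>a\<close> to a set where its density is at most \<open>K\<close> gives \<open>\<lambda> \<le> \<mu>\<close> with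
  \<open>\<lambda> \<le> K \<nu>\<close> and almost the same mass. As \<open>a\<^sup>\<alpha> b\<^bsup>1-\<alpha>\<^esup> \<ge> K\<^bsup>\<alpha>-1\<^esup> min a (K b)\<close>, the sums are at least
  \<open>K\<^bsup>\<alpha>-1\<^esup>\<close> times the mass of \<open>\<lambda>\<close>, uniformly in \<open>n\<close>.\<close>

section \<open>Hellinger integrals of partial densities\<close>

lemma powr_mult_powr_le_weighted:
  fixes a b x :: real
  assumes "0 \<le> a" "0 \<le> b" "0 < x" "x < 1"
  shows "a powr x * b powr (1 - x) \<le> x * a + (1 - x) * b"
  using Youngs_inequality_0[of x "1 - x" a b] assms
  by (cases "a = 0 \<or> b = 0") auto

text \<open>Writing \<open>b = d * (b / d)\<close> extracts the factor
  \<open>d powr (1 - x)\<close>, and Young's inequality applies to \<open>a\<close> and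
  \<open>b / d\<close>. The bound serves on a set of \<open>\<nu>\<close>-mass at most
  \<open>d\<close>, where \<open>b / d\<close> still integrates to at most 1 while the prefactor can
  be made small.\<close>

lemma powr_mult_powr_le_scaled:
  fixes a b x d :: real
  assumes "0 \<le> a" "0 \<le> b" "0 < x" "x < 1" "0 < d"
  shows "a powr x * b powr (1 - x) \<le> d powr (1 - x) * (a + b / d)"
proof -
  have "a powr x * b powr (1 - x) = d powr (1 - x) * (a powr x * (b / d) powr (1 - x))"
    using assms by (simp add: powr_divide)
  also have "a powr x * (b / d) powr (1 - x) \<le> x * a + (1 - x) * (b / d)"
    using assms by (intro powr_mult_powr_le_weighted) auto
  also have "\<dots> \<le> a + b / d"
    using assms by (intro add_mono mult_left_le_one_le) auto
  finally show ?thesis by (simp add: mult_left_mono)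
qed

text \<open>With \<open>m = min a (K * b)\<close> one has \<open>m \<le> a\<close> and
  \<open>m / K \<le> b\<close>. The left side is the value of the integrand at
  \<open>(m, m / K)\<close>, and powers with positive exponents are monotone.\<close>

lemma powr_mult_powr_ge_min:
  fixes a b x K :: real
  assumes "0 \<le> a" "0 \<le> b" "0 < x" "x < 1" "0 < K"
  shows "K powr (x - 1) * min a (K * b) \<le> a powr x * b powr (1 - x)"
proof -
  define m where "m = min a (K * b)"
  have m: "0 \<le> m" "m \<le> a" "m / K \<le> b"
    using assms by (auto simp: m_def field_simps min_def)
  have "K powr (x - 1) * m = m powr x * (m / K) powr (1 - x)"
  proof (cases "m = 0")
    case False
    then have "m powr x * m powr (1 - x) = m" using m by (simp flip: powr_add)
    moreover have "K powr (x - 1) = 1 / K powr (1 - x)"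
      using powr_minus_divide[of K "1 - x"] by simp
    ultimately show ?thesis using m assms by (simp add: powr_divide)
  qed simp
  also have "\<dots> \<le> a powr x * b powr (1 - x)"
    using m assms by (intro mult_mono powr_mono2) auto
  finally show ?thesis by (simp add: m_def)
qed

text \<open>This is the Radon-Nikodym density on \<open>N\<close> of the trace measure sending
  \<open>A\<close> to \<open>measure \<mu> (A \<inter> D)\<close>. The set \<open>D\<close> may lie
  outside \<open>sets N\<close>: a cell is in general decided only at the right end of its time
  interval, whereas \<open>N\<close> carries the \<sigma>-algebra of the left end.\<close>

definition density_on :: "'a measure \<Rightarrow> 'a measure \<Rightarrow> 'a set \<Rightarrow> ('a \<Rightarrow> real) \<Rightarrow> bool" where
  "density_on N \<mu> D g \<longleftrightarrow> integrable N g \<and> (AE \<omega> in N. 0 \<le> g \<omega>) \<and>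
     (\<forall>A\<in>sets N. (\<integral>\<omega>. g \<omega> * indicator A \<omega> \<partial>N) = measure \<mu> (A \<inter> D))"

lemma density_onD:
  assumes "density_on N \<mu> D g"
  shows "integrable N g" "AE \<omega> in N. 0 \<le> g \<omega>"
    "A \<in> sets N \<Longrightarrow> (\<integral>\<omega>. g \<omega> * indicator A \<omega> \<partial>N) = measure \<mu> (A \<inter> D)"
    "A \<in> sets N \<Longrightarrow> integrable N (\<lambda>\<omega>. g \<omega> * indicator A \<omega>)"
  using assms by (auto simp: density_on_def intro: integrable_real_mult_indicator)

lemma integrable_powr_mult_powr:
  fixes g g' :: "'a \<Rightarrow> real"
  assumes "integrable N g" "integrable N g'" "AE \<omega> in N. 0 \<le> g \<omega>" "AE \<omega> in N. 0 \<le> g' \<omega>"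
    and "0 < x" "x < 1"
  shows "integrable N (\<lambda>\<omega>. g \<omega> powr x * g' \<omega> powr (1 - x))"
proof (rule Bochner_Integration.integrable_bound)
  show "integrable N (\<lambda>\<omega>. x * g \<omega> + (1 - x) * g' \<omega>)" using assms by auto
  show "(\<lambda>\<omega>. g \<omega> powr x * g' \<omega> powr (1 - x)) \<in> borel_measurable N"
    using assms(1,2)[THEN borel_measurable_integrable] by measurable
  show "AE \<omega> in N. norm (g \<omega> powr x * g' \<omega> powr (1 - x)) \<le> norm (x * g \<omega> + (1 - x) * g' \<omega>)"
    using assms(3,4)
  proof eventually_elim
    case (elim \<omega>)
    then show ?case using powr_mult_powr_le_weighted[of "g \<omega>" "g' \<omega>" x] assms by auto
  qed
qed

text \<open>The scaled bound is used on \<open>A\<close> and the weighted one off \<open>A\<close>.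
  Both are linear in \<open>g\<close> and \<open>g'\<close>, so their integrals are known from
  \<open>density_on\<close> alone, without any knowledge of the joint behaviour of the two
  densities.\<close>

lemma hellinger_le:
  assumes g: "density_on N \<mu> D g" and g': "density_on N \<nu> D g'"
    and A: "A \<in> sets N" and x: "0 < x" "x < 1" and d: "0 < d"
  shows "(\<integral>\<omega>. g \<omega> powr x * g' \<omega> powr (1 - x) \<partial>N) \<le>
    d powr (1 - x) * (measure \<mu> (A \<inter> D) + measure \<nu> (A \<inter> D) / d)
    + (measure \<mu> ((space N - A) \<inter> D) + (1 - x) * measure \<nu> ((space N - A) \<inter> D))"
    (is "?L \<le> ?R")
proof -
  note G = density_onD[OF g] and G' = density_onD[OF g']
  let ?C = "space N - A"
  have C: "?C \<in> sets N" using A by auto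
  let ?f = "\<lambda>\<omega>. d powr (1 - x) * (g \<omega> * indicator A \<omega> + g' \<omega> * indicator A \<omega> / d)
    + (g \<omega> * indicator ?C \<omega> + (1 - x) * (g' \<omega> * indicator ?C \<omega>))"
  have int: "integrable N (\<lambda>\<omega>. g \<omega> * indicator A \<omega>)" "integrable N (\<lambda>\<omega>. g' \<omega> * indicator A \<omega>)"
    "integrable N (\<lambda>\<omega>. g \<omega> * indicator ?C \<omega>)" "integrable N (\<lambda>\<omega>. g' \<omega> * indicator ?C \<omega>)"
    using A C G(4) G'(4) by blast+
  have "?L \<le> (\<integral>\<omega>. ?f \<omega> \<partial>N)"
  proof (rule integral_mono_AE)
    show "integrable N (\<lambda>\<omega>. g \<omega> powr x * g' \<omega> powr (1 - x))"
      using G G' x by (intro integrable_powr_mult_powr)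
    show "integrable N ?f"
      using int by (intro Bochner_Integration.integrable_add integrable_mult_right integrable_divide)
    show "AE \<omega> in N. g \<omega> powr x * g' \<omega> powr (1 - x) \<le> ?f \<omega>"
      using G(2) G'(2) AE_space
    proof eventually_elim
      case (elim \<omega>)
      \<comment> \<open>Off \<open>A\<close> the weight \<open>x\<close> in front of
        \<open>g\<close> is dropped, while the weight \<open>1 - x\<close> in front of
        \<open>g'\<close> is kept because it tends to 0.\<close>
      have "x * g \<omega> \<le> g \<omega>" using elim x by (intro mult_left_le_one_le) auto
      then show ?case
        using elim powr_mult_powr_le_scaled[of "g \<omega>" "g' \<omega>" x d]
          powr_mult_powr_le_weighted[of "g \<omega>" "g' \<omega>" x] x d
        by (cases "\<omega> \<in> A") auto
    qed
  qed
  also have "(\<integral>\<omega>. ?f \<omega> \<partial>N) = ?R"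
    using int by (simp add: G(3) G'(3) A C)
  finally show ?thesis .
qed

text \<open>Splitting the space according to whether \<open>g \<le> K * g'\<close> bounds
  \<open>l\<close> by the integral of \<open>min g (K * g')\<close>; the pointwise lower bound then
  finishes. Of \<open>l\<close> only subadditivity over a set of \<open>N\<close> and its complement
  is asked, since it is evaluated on traces on \<open>D\<close>, which may lie outside
  \<open>N\<close>.\<close>

lemma hellinger_ge:
  fixes l :: "'a set \<Rightarrow> real"
  assumes g: "density_on N \<mu> D g" and g': "density_on N \<nu> D g'"
    and x: "0 < x" "x < 1" and K: "0 < K"
    and l\<mu>: "\<And>A. A \<in> sets N \<Longrightarrow> l (A \<inter> D) \<le> measure \<mu> (A \<inter> D)"
    and l\<nu>: "\<And>A. A \<in> sets N \<Longrightarrow> l (A \<inter> D) \<le> K * measure \<nu> (A \<inter> D)"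
    and l: "\<And>A. A \<in> sets N \<Longrightarrow> l (space N \<inter> D) \<le> l (A \<inter> D) + l ((space N - A) \<inter> D)"
  shows "K powr (x - 1) * l (space N \<inter> D) \<le> (\<integral>\<omega>. g \<omega> powr x * g' \<omega> powr (1 - x) \<partial>N)"
proof -
  note G = density_onD[OF g] and G' = density_onD[OF g']
  have [measurable]: "g \<in> borel_measurable N" "g' \<in> borel_measurable N" using G(1) G'(1) by auto
  define A where "A = {\<omega> \<in> space N. g \<omega> \<le> K * g' \<omega>}"
  have A: "A \<in> sets N" unfolding A_def by measurable
  let ?C = "space N - A"
  have C: "?C \<in> sets N" using A by auto
  have int: "integrable N (\<lambda>\<omega>. g \<omega> * indicator A \<omega>)" "integrable N (\<lambda>\<omega>. g' \<omega> * indicator ?C \<omega>)"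
    using A C G(4) G'(4) by blast+
  have "l (space N \<inter> D) \<le> l (A \<inter> D) + l (?C \<inter> D)" by (rule l[OF A])
  also have "\<dots> \<le> measure \<mu> (A \<inter> D) + K * measure \<nu> (?C \<inter> D)"
    by (intro add_mono l\<mu> l\<nu> A C)
  also have "\<dots> = (\<integral>\<omega>. g \<omega> * indicator A \<omega> + K * (g' \<omega> * indicator ?C \<omega>) \<partial>N)"
    using int by (simp add: G(3) G'(3) A C)
  also have "\<dots> = (\<integral>\<omega>. min (g \<omega>) (K * g' \<omega>) \<partial>N)"
    by (intro Bochner_Integration.integral_cong) (auto simp: A_def indicator_def min_def)
  finally have "K powr (x - 1) * l (space N \<inter> D) \<le> K powr (x - 1) * (\<integral>\<omega>. min (g \<omega>) (K * g' \<omega>) \<partial>N)"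
    by (rule mult_left_mono) simp
  also have "\<dots> = (\<integral>\<omega>. K powr (x - 1) * min (g \<omega>) (K * g' \<omega>) \<partial>N)" by simp
  also have "\<dots> \<le> (\<integral>\<omega>. g \<omega> powr x * g' \<omega> powr (1 - x) \<partial>N)"
  proof (rule integral_mono_AE)
    show "integrable N (\<lambda>\<omega>. K powr (x - 1) * min (g \<omega>) (K * g' \<omega>))"
      using G(1) G'(1) by (intro integrable_mult_right integrable_min)
    show "integrable N (\<lambda>\<omega>. g \<omega> powr x * g' \<omega> powr (1 - x))"
      using G G' x by (intro integrable_powr_mult_powr)
    show "AE \<omega> in N. K powr (x - 1) * min (g \<omega>) (K * g' \<omega>) \<le> g \<omega> powr x * g' \<omega> powr (1 - x)"
      using G(2) G'(2) by eventually_elim (use x K in \<open>auto intro: powr_mult_powr_ge_min\<close>)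
  qed
  finally show ?thesis .
qed

text \<open>When \<open>D\<close> itself belongs to \<open>G\<close>, multiplying the density by its
  indicator gives the density of the trace. This covers the two outer cells, \<open>T = 0\<close>
  and \<open>n < T\<close>.\<close>

lemma density_on_indicator:
  assumes sub: "subalgebra P G" and "finite_measure \<mu>" and sets: "sets \<mu> = sets P"
    and z [measurable]: "z \<in> borel_measurable G" and pos: "\<And>\<omega>. \<omega> \<in> space P \<Longrightarrow> 0 \<le> z \<omega>"
    and dens: "restr_to_subalg \<mu> G = density (restr_to_subalg P G) (\<lambda>\<omega>. ennreal (z \<omega>))"
    and D: "D \<inter> space P \<in> sets G"
  shows "density_on (restr_to_subalg P G) \<mu> D (\<lambda>\<omega>. z \<omega> * indicator D \<omega>)"
proof -
  interpret \<mu>: finite_measure \<mu> by fact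
  let ?N = "restr_to_subalg P G"
  have sp: "space G = space P" "space \<mu> = space P"
    using sub sets_eq_imp_space_eq[OF sets] by (auto simp: subalgebra_def)
  have sub\<mu>: "subalgebra \<mu> G" using sub sets sp by (auto simp: subalgebra_def)
  have setsN [measurable_cong]: "sets ?N = sets G" by (rule sets_restr_to_subalg[OF sub])
  have ind [measurable]: "(\<lambda>\<omega>. indicator D \<omega> :: real) \<in> borel_measurable G"
    using D sp borel_measurable_indicator_iff by (metis)
  let ?g = "\<lambda>\<omega>. z \<omega> * indicator D \<omega>"
  \<comment> \<open>The identity is proved first for nonnegative integrals:
    \<open>A = space P\<close> then yields integrability, and general \<open>A\<close> the required
    values.\<close>
  have *: "(\<integral>\<^sup>+\<omega>. ennreal (?g \<omega> * indicator A \<omega>) \<partial>?N) = emeasure \<mu> (A \<inter> D)" if "A \<in> sets G" for A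
  proof -
    have AD: "A \<inter> D \<in> sets G"
    proof -
      have "A \<inter> D = A \<inter> (D \<inter> space P)" using sets.sets_into_space[OF that] sp by auto
      then show ?thesis using sets.Int[OF that D] by simp
    qed
    have "emeasure \<mu> (A \<inter> D) = emeasure (restr_to_subalg \<mu> G) (A \<inter> D)"
      using sub\<mu> AD by (simp add: emeasure_restr_to_subalg)
    also have "\<dots> = (\<integral>\<^sup>+\<omega>. ennreal (z \<omega>) * indicator (A \<inter> D) \<omega> \<partial>?N)"
      unfolding dens using AD by (subst emeasure_density) (auto simp: setsN)
    also have "\<dots> = (\<integral>\<^sup>+\<omega>. ennreal (?g \<omega> * indicator A \<omega>) \<partial>?N)"
      by (intro nn_integral_cong) (auto simp: indicator_def)
    finally show ?thesis by simp
  qed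
  have int: "integrable ?N ?g"
  proof (rule integrableI_nonneg)
    show "AE \<omega> in ?N. 0 \<le> ?g \<omega>" using pos by (auto simp: space_restr_to_subalg)
    have "(\<integral>\<^sup>+\<omega>. ennreal (?g \<omega>) \<partial>?N) = (\<integral>\<^sup>+\<omega>. ennreal (?g \<omega> * indicator (space P) \<omega>) \<partial>?N)"
      by (intro nn_integral_cong) (auto simp: space_restr_to_subalg)
    then show "(\<integral>\<^sup>+\<omega>. ennreal (?g \<omega>) \<partial>?N) < \<infinity>"
      using *[of "space P"] sp by (metis \<mu>.emeasure_finite sets.top less_top infinity_ennreal_def)
  qed measurable
  have "(\<integral>\<omega>. ?g \<omega> * indicator A \<omega> \<partial>?N) = measure \<mu> (A \<inter> D)" if "A \<in> sets G" for A
    using *[OF that] that pos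
    by (subst integral_eq_nn_integral) (auto simp: measure_def space_restr_to_subalg)
  then show ?thesis
    using int pos by (auto simp: density_on_def setsN space_restr_to_subalg)
qed

text \<open>For \<open>A\<close> in the smaller \<sigma>-algebra \<open>H\<close>, the defining
  property of conditional expectation moves the integral over \<open>A\<close> from \<open>H\<close>
  up to \<open>G\<close>, where \<open>D\<close> is measurable and the previous lemma applies. This
  covers the middle cells, with \<open>H\<close> at the left and \<open>G\<close> at the right end
  of the time interval.\<close>

lemma density_on_real_cond_exp:
  assumes sub: "subalgebra P G" and sub': "subalgebra P H" and GH: "sets H \<subseteq> sets G"
    and P: "finite_measure P" and "finite_measure \<mu>" and sets: "sets \<mu> = sets P"
    and z: "z \<in> borel_measurable G" and pos: "\<And>\<omega>. \<omega> \<in> space P \<Longrightarrow> 0 \<le> z \<omega>"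
    and dens: "restr_to_subalg \<mu> G = density (restr_to_subalg P G) (\<lambda>\<omega>. ennreal (z \<omega>))"
    and D: "D \<inter> space P \<in> sets G"
  shows "density_on (restr_to_subalg P H) \<mu> D (real_cond_exp P H (\<lambda>\<omega>. z \<omega> * indicator D \<omega>))"
proof -
  interpret finite_measure_subalgebra P H
    using P sub' by (auto simp: finite_measure_subalgebra_def finite_measure_subalgebra_axioms_def)
  let ?g = "\<lambda>\<omega>. z \<omega> * indicator D \<omega>"
  have dG: "density_on (restr_to_subalg P G) \<mu> D ?g"
    by (rule density_on_indicator[OF sub assms(5-10)])
  have int: "integrable P ?g" using integrable_from_subalg[OF sub density_onD(1)[OF dG]] .
  have [measurable]: "?g \<in> borel_measurable P" using int by auto
  have gG [measurable]: "?g \<in> borel_measurable G"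
    using density_onD(1)[OF dG, THEN borel_measurable_integrable] measurable_in_subalg'[OF sub] by blast
  have "AE \<omega> in P. 0 \<le> real_cond_exp P H ?g \<omega>"
    by (rule real_cond_exp_pos) (use pos in auto)
  then have nn: "AE \<omega> in restr_to_subalg P H. 0 \<le> real_cond_exp P H ?g \<omega>"
    by (rule AE_restr_to_subalg2[OF sub']) measurable
  have "(\<integral>\<omega>. real_cond_exp P H ?g \<omega> * indicator A \<omega> \<partial>restr_to_subalg P H) = measure \<mu> (A \<inter> D)"
    if A [measurable]: "A \<in> sets H" for A
  proof -
    have AG [measurable]: "A \<in> sets G" using A GH by auto
    have "(\<integral>\<omega>. real_cond_exp P H ?g \<omega> * indicator A \<omega> \<partial>restr_to_subalg P H)
      = (\<integral>\<omega>. real_cond_exp P H ?g \<omega> * indicator A \<omega> \<partial>P)"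
      by (rule integral_subalgebra2[OF sub']) measurable
    also have "\<dots> = (\<integral>\<omega>. ?g \<omega> * indicator A \<omega> \<partial>P)"
      using real_cond_exp_intA[OF int A] by (simp add: set_lebesgue_integral_def mult.commute)
    also have "\<dots> = (\<integral>\<omega>. ?g \<omega> * indicator A \<omega> \<partial>restr_to_subalg P G)"
      by (rule integral_subalgebra2[OF sub, symmetric]) measurable
    also have "\<dots> = measure \<mu> (A \<inter> D)"
      using AG by (intro density_onD(3)[OF dG]) (simp add: sets_restr_to_subalg[OF sub])
    finally show ?thesis .
  qed
  then show ?thesis
    using nn real_cond_exp_int(1)[OF int]
    by (auto simp: density_on_def sets_restr_to_subalg[OF sub'] intro!: integrable_in_subalg[OF sub'])
qed

section \<open>Approximation by a generating sequence of algebras\<close>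

text \<open>Good sets principle: approximability to every precision passes to complements and
  countable unions. Working with the sum \<open>q\<close> of the two measures makes one set
  \<open>B\<close> serve for both.\<close>

lemma sigma_sets_approx_two_measures:
  fixes G :: "nat \<Rightarrow> 'a set set"
  assumes "finite_measure \<mu>" "finite_measure \<nu>" and sets: "sets \<nu> = sets \<mu>"
    and G: "\<And>n. G n \<subseteq> sets \<mu>" and mono: "\<And>n m. n \<le> m \<Longrightarrow> G n \<subseteq> G m"
    and empty: "\<And>n. {} \<in> G n"
    and compl: "\<And>n B. B \<in> G n \<Longrightarrow> space \<mu> - B \<in> G n"
    and un: "\<And>n B C. B \<in> G n \<Longrightarrow> C \<in> G n \<Longrightarrow> B \<union> C \<in> G n"
    and Z: "Z \<in> sigma_sets (space \<mu>) (\<Union>n. G n)" and d: "0 < d"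
  shows "\<exists>n. \<exists>B\<in>G n. measure \<mu> (sym_diff Z B) + measure \<nu> (sym_diff Z B) < d"
proof -
  interpret \<mu>: finite_measure \<mu> by fact
  interpret \<nu>: finite_measure \<nu> by fact
  define q where "q X = measure \<mu> X + measure \<nu> X" for X
  have q_mono: "q X \<le> q Y" if "X \<subseteq> Y" "Y \<in> sets \<mu>" for X Y
    unfolding q_def using that sets by (intro add_mono \<mu>.finite_measure_mono \<nu>.finite_measure_mono) auto
  have q_Un: "q (X \<union> Y) \<le> q X + q Y" if "X \<in> sets \<mu>" "Y \<in> sets \<mu>" for X Y
    unfolding q_def using that sets measure_Un_le[of X \<mu> Y] measure_Un_le[of X \<nu> Y] by auto
  define approx where "approx Z \<longleftrightarrow> (\<forall>d>0. \<exists>n. \<exists>B\<in>G n. q (sym_diff Z B) < d)" for Z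
  have exact: "approx Z" if "Z \<in> G n" for Z n
    unfolding approx_def using that by (intro allI impI exI[of _ n] bexI[of _ Z]) (auto simp: q_def)
  have Un: "approx (X \<union> Y)" if X: "approx X" "X \<in> sets \<mu>" and Y: "approx Y" "Y \<in> sets \<mu>" for X Y
    unfolding approx_def
  proof (intro allI impI)
    fix d :: real assume "0 < d"
    then have d: "0 < d / 2" by simp
    obtain n B where B: "B \<in> G n" "q (sym_diff X B) < d / 2" using X d unfolding approx_def by blast
    obtain m C where C: "C \<in> G m" "q (sym_diff Y C) < d / 2" using Y d unfolding approx_def by blast
    have "B \<union> C \<in> G (max n m)"
      using B C mono[of n "max n m"] mono[of m "max n m"] by (intro un) auto
    moreover have "q (sym_diff (X \<union> Y) (B \<union> C)) < d"
    proof -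
      have m: "B \<in> sets \<mu>" "C \<in> sets \<mu>" using B C G by auto
      have "q (sym_diff (X \<union> Y) (B \<union> C)) \<le> q (sym_diff X B \<union> sym_diff Y C)"
        using m X Y by (intro q_mono) auto
      also have "\<dots> \<le> q (sym_diff X B) + q (sym_diff Y C)"
        using m X Y by (intro q_Un) auto
      finally show ?thesis using B C by simp
    qed
    ultimately show "\<exists>n. \<exists>B\<in>G n. q (sym_diff (X \<union> Y) B) < d" by blast
  qed
  have G': "(\<Union>n. G n) \<subseteq> sets \<mu>" using G by auto
  have meas: "Z \<in> sets \<mu>" if "Z \<in> sigma_sets (space \<mu>) (\<Union>n. G n)" for Z
    using that G' sets.sigma_sets_subset by blast
  from Z have "approx Z"
  proof (induction Z)
    case (Basic a)
    then show ?case using exact by auto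
  next
    case Empty
    show ?case using exact[OF empty[of 0]] .
  next
    case (Compl a)
    show ?case unfolding approx_def
    proof (intro allI impI)
      fix d :: real assume "0 < d"
      then obtain n B where B: "B \<in> G n" "q (sym_diff a B) < d" using Compl unfolding approx_def by blast
      have "a \<subseteq> space \<mu>" "B \<subseteq> space \<mu>"
        using meas[OF Compl(1)] B G[of n] sets.sets_into_space[of _ \<mu>] by blast+
      then have "sym_diff (space \<mu> - a) (space \<mu> - B) = sym_diff a B" by auto
      then show "\<exists>n. \<exists>B\<in>G n. q (sym_diff (space \<mu> - a) B) < d" using B compl by metis
    qed
  next
    case (Union a)
    have am: "a i \<in> sets \<mu>" for i using meas Union(1) by blast
    \<comment> \<open>Finite partial unions increase to the full union, so by continuity from below
      one of them misses at most \<open>d / 2\<close>; approximating that one costs the other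
      \<open>d / 2\<close>.\<close>
    define U where "U N = (\<Union>i<N. a i)" for N :: nat
    have Um: "U N \<in> sets \<mu>" for N unfolding U_def using am by auto
    have UU: "(\<Union>i. a i) = (\<Union>N. U N)" unfolding U_def by auto
    have Ua: "approx (U N)" for N
    proof (induction N)
      case 0
      show ?case unfolding U_def using exact[OF empty[of 0]] by simp
    next
      case (Suc N)
      have "U (Suc N) = U N \<union> a N" unfolding U_def by (auto simp: less_Suc_eq)
      then show ?case using Un[OF Suc Um Union.IH am] by simp
    qed
    have inc: "incseq U" unfolding U_def incseq_def by fastforce
    have "(\<lambda>N. measure \<mu> (U N) + measure \<nu> (U N)) \<longlonglongrightarrow> measure \<mu> (\<Union>N. U N) + measure \<nu> (\<Union>N. U N)"
      using Um sets inc
      by (intro tendsto_add \<mu>.finite_Lim_measure_incseq \<nu>.finite_Lim_measure_incseq) auto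
    then have lim: "(\<lambda>N. q (U N)) \<longlonglongrightarrow> q (\<Union>N. U N)" by (simp add: q_def)
    show ?case unfolding approx_def
    proof (intro allI impI)
      fix d :: real assume "0 < d"
      then have d: "0 < d / 2" by simp
      obtain N where "dist (q (U N)) (q (\<Union>N. U N)) < d / 2"
        using LIMSEQ_D[OF lim d] by (auto simp: dist_norm)
      then have "q (\<Union>N. U N) - q (U N) < d / 2" unfolding dist_real_def by linarith
      moreover have "q ((\<Union>N. U N) - U N) = q (\<Union>N. U N) - q (U N)"
        unfolding q_def using Um sets
        by (subst \<mu>.finite_measure_Diff, (auto)[3], subst \<nu>.finite_measure_Diff) auto
      ultimately have N: "q ((\<Union>N. U N) - U N) < d / 2" by simp
      obtain n B where B: "B \<in> G n" "q (sym_diff (U N) B) < d / 2"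
        using Ua[of N] d unfolding approx_def by blast
      have m: "B \<in> sets \<mu>" using B G by auto
      have "q (sym_diff (\<Union>N. U N) B) \<le> q (((\<Union>N. U N) - U N) \<union> sym_diff (U N) B)"
        using m Um by (intro q_mono) auto
      also have "\<dots> \<le> q ((\<Union>N. U N) - U N) + q (sym_diff (U N) B)"
        using m Um by (intro q_Un) auto
      finally show "\<exists>n. \<exists>B\<in>G n. q (sym_diff (\<Union>i. a i) B) < d"
        using B N unfolding UU by (intro exI[of _ n] bexI[of _ B]) auto
    qed
  qed
  then show ?thesis using d unfolding approx_def q_def by blast
qed

section \<open>Dyadic discretisation of the strict past\<close>

text \<open>The cells \<open>k = 0\<close>, \<open>1 \<le> k \<le> n 2\<^sup>n\<close> and \<open>k = n 2\<^sup>n + 1\<close> are the events \<open>T = 0\<close>,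
  \<open>(k - 1) / 2\<^sup>n < T \<le> k / 2\<^sup>n\<close> and \<open>n < T\<close>.\<close>

definition dyadic_cell :: "('a \<Rightarrow> ennreal) \<Rightarrow> nat \<Rightarrow> nat \<Rightarrow> 'a set" where
  "dyadic_cell T n k = {\<omega>. (0 < k \<longrightarrow> ennreal (real (k - 1) / 2 ^ n) < T \<omega>) \<and>
     (k \<le> n * 2 ^ n \<longrightarrow> T \<omega> \<le> ennreal (real k / 2 ^ n))}"

text \<open>Membership is tested on traces because a cell need not belong to \<open>F\<close> at its
  left endpoint. Truncated subtraction sends index 0 to time 0, so indices 0 and 1 both use
  \<open>F 0\<close>.\<close>

definition dyadic_past ::
    "'a measure \<Rightarrow> (real \<Rightarrow> 'a measure) \<Rightarrow> ('a \<Rightarrow> ennreal) \<Rightarrow> nat \<Rightarrow> 'a set set" where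
  "dyadic_past M F T n = {B \<in> sets M. \<forall>k\<le>n * 2 ^ n + 1.
     \<exists>A\<in>sets (F (real (k - 1) / 2 ^ n)). B \<inter> dyadic_cell T n k = A \<inter> dyadic_cell T n k}"

section \<open>The cells as a partition, and its refinement\<close>

lemma disjoint_family_dyadic_cell: "disjoint_family_on (dyadic_cell T n) {..n * 2 ^ n + 1}"
proof -
  have "dyadic_cell T n j \<inter> dyadic_cell T n k = {}" if "j < k" "k \<le> n * 2 ^ n + 1" for j k
  proof -
    have le: "ennreal (real j / 2 ^ n) \<le> ennreal (real (k - 1) / 2 ^ n)"
      using that by (intro ennreal_leI divide_right_mono) auto
    \<comment> \<open>From \<open>j < k \<le> n * 2 ^ n + 1\<close> it follows that \<open>j\<close>
      is not the last index, so the upper bound in cell \<open>j\<close> is in force.\<close>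
    have "T \<omega> \<le> ennreal (real j / 2 ^ n)" "ennreal (real (k - 1) / 2 ^ n) < T \<omega>"
      if "\<omega> \<in> dyadic_cell T n j" "\<omega> \<in> dyadic_cell T n k" for \<omega>
      using that \<open>j < k\<close> \<open>k \<le> n * 2 ^ n + 1\<close> unfolding dyadic_cell_def by simp_all
    then show ?thesis using le by (meson disjoint_iff leD order.trans)
  qed
  then show ?thesis unfolding disjoint_family_on_def
    by (metis Int_commute atMost_iff linorder_neqE_nat)
qed

lemma Union_dyadic_cell: "(\<Union>k\<le>n * 2 ^ n + 1. dyadic_cell T n k) = UNIV"
proof (intro set_eqI iffI UNIV_I)
  fix \<omega>
  let ?Q = "\<lambda>k. k > n * 2 ^ n \<or> T \<omega> \<le> ennreal (real k / 2 ^ n)"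
  \<comment> \<open>The cell of \<omega> has the least index whose upper condition holds; failure of
    that condition at \<open>k - 1\<close> is the lower bound on \<open>T \<omega>\<close>.\<close>
  define k where "k = (LEAST k. ?Q k)"
  have Q: "?Q (n * 2 ^ n + 1)" by simp
  have k: "?Q k" "k \<le> n * 2 ^ n + 1"
    unfolding k_def using LeastI[of ?Q, OF Q] Least_le[of ?Q, OF Q] by auto
  have "\<not> ?Q (k - 1)" if "0 < k" using not_less_Least[of "k - 1" ?Q] that unfolding k_def by auto
  then have "\<omega> \<in> dyadic_cell T n k" using k unfolding dyadic_cell_def by auto
  then show "\<omega> \<in> (\<Union>k\<le>n * 2 ^ n + 1. dyadic_cell T n k)" using k by auto
qed

text \<open>Besides the inclusion, the parent cell has a left end no later than that of the child;
  this is what makes the algebras \<open>dyadic_past\<close> increase.\<close>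

lemma dyadic_cell_refines:
  assumes "k \<le> Suc n * 2 ^ Suc n + 1"
  obtains j where "j \<le> n * 2 ^ n + 1" "dyadic_cell T (Suc n) k \<subseteq> dyadic_cell T n j"
    "real (j - 1) / 2 ^ n \<le> real (k - 1) / 2 ^ Suc n"
proof
  \<comment> \<open>The first term is \<open>k / 2\<close> rounded up. The minimum sends all cells
    beyond time \<open>n\<close>, which level \<open>Suc n\<close> still subdivides, to the last
    cell \<open>n < T\<close>.\<close>
  define j where "j = min ((k + 1) div 2) (n * 2 ^ n + 1)"
  show "j \<le> n * 2 ^ n + 1" by (simp add: j_def)
  have "2 * (j - 1) \<le> k - 1" unfolding j_def by linarith
  then have "2 * real (j - 1) \<le> real (k - 1)" by (metis of_nat_le_iff of_nat_mult of_nat_numeral)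
  then show le: "real (j - 1) / 2 ^ n \<le> real (k - 1) / 2 ^ Suc n" by (simp add: field_simps)
  show "dyadic_cell T (Suc n) k \<subseteq> dyadic_cell T n j"
  proof
    fix \<omega> assume w: "\<omega> \<in> dyadic_cell T (Suc n) k"
    have "ennreal (real (j - 1) / 2 ^ n) < T \<omega>" if "0 < j"
    proof -
      have "0 < k" using that unfolding j_def by auto
      then have "ennreal (real (k - 1) / 2 ^ Suc n) < T \<omega>" using w unfolding dyadic_cell_def by auto
      then show ?thesis using ennreal_leI[OF le] by (rule order.strict_trans1[rotated])
    qed
    moreover have "T \<omega> \<le> ennreal (real j / 2 ^ n)" if "j \<le> n * 2 ^ n"
    proof -
      have k: "k \<le> 2 * j" using that unfolding j_def by linarith
      also have "\<dots> \<le> Suc n * 2 ^ Suc n" using that by simp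
      finally have "T \<omega> \<le> ennreal (real k / 2 ^ Suc n)" using w unfolding dyadic_cell_def by auto
      also have "\<dots> \<le> ennreal (real j / 2 ^ n)"
        using k by (intro ennreal_leI) (simp add: field_simps)
      finally show ?thesis .
    qed
    ultimately show "\<omega> \<in> dyadic_cell T n j" unfolding dyadic_cell_def by auto
  qed
qed

section \<open>Measurability of the cells and generation of the strict past\<close>

context
  fixes M :: "'a measure" and F :: "real \<Rightarrow> 'a measure"
  assumes F: "filtered_space M F"
begin

lemma filtration_subalgebra: "0 \<le> t \<Longrightarrow> subalgebra M (F t)"
  and filtration_space: "0 \<le> t \<Longrightarrow> space (F t) = space M"
  and filtration_mono: "0 \<le> s \<Longrightarrow> s \<le> t \<Longrightarrow> sets (F s) \<subseteq> sets (F t)"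
  and filtration_sets: "0 \<le> t \<Longrightarrow> sets (F t) \<subseteq> sets M"
  using F by (auto simp: filtered_space_def subalgebra_def)

context
  fixes T :: "'a \<Rightarrow> ennreal"
  assumes T: "ext_stopping_time F T"
begin

lemma stopping_time_le_sets: "0 \<le> t \<Longrightarrow> {\<omega> \<in> space M. T \<omega> \<le> ennreal t} \<in> sets (F t)"
  using T filtration_space[of t] unfolding ext_stopping_time_def pred_def by metis

lemma stopping_time_gt_sets: "0 \<le> t \<Longrightarrow> {\<omega> \<in> space M. ennreal t < T \<omega>} \<in> sets (F t)"
proof -
  assume t: "0 \<le> t"
  have "{\<omega> \<in> space M. ennreal t < T \<omega>} = space (F t) - {\<omega> \<in> space M. T \<omega> \<le> ennreal t}"
    using filtration_space[OF t] by auto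
  then show ?thesis using stopping_time_le_sets[OF t] by auto
qed

text \<open>A cell is decided once its last endpoint has been reached: \<open>k / 2 ^ n\<close> in
  general, and already \<open>n\<close> for the last cell, which has no upper bound.\<close>

lemma dyadic_cell_sets:
  assumes "k \<le> n * 2 ^ n + 1" "(if k \<le> n * 2 ^ n then real k / 2 ^ n else real n) \<le> t"
  shows "dyadic_cell T n k \<inter> space M \<in> sets (F t)"
proof -
  have t: "0 \<le> t" using assms(2) by (auto intro: order_trans[rotated] split: if_splits)
  have le: "real (k - 1) / 2 ^ n \<le> t"
  proof (cases "k \<le> n * 2 ^ n")
    case True
    then have "real (k - 1) / 2 ^ n \<le> real k / 2 ^ n" by (intro divide_right_mono) auto
    then show ?thesis using True assms by simp
  next
    case False
    then have "k - 1 = n * 2 ^ n" using assms by simp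
    then show ?thesis using False assms by simp
  qed
  define L where "L = (if 0 < k then {\<omega> \<in> space M. ennreal (real (k - 1) / 2 ^ n) < T \<omega>} else space (F t))"
  define R where "R = (if k \<le> n * 2 ^ n then {\<omega> \<in> space M. T \<omega> \<le> ennreal (real k / 2 ^ n)} else space (F t))"
  have "{\<omega> \<in> space M. ennreal (real (k - 1) / 2 ^ n) < T \<omega>} \<in> sets (F t)"
    by (rule subsetD[OF filtration_mono[OF _ le] stopping_time_gt_sets]) auto
  then have "L \<in> sets (F t)" unfolding L_def by auto
  moreover have "{\<omega> \<in> space M. T \<omega> \<le> ennreal (real k / 2 ^ n)} \<in> sets (F t)" if "k \<le> n * 2 ^ n"
    by (rule subsetD[OF filtration_mono stopping_time_le_sets]) (use assms(2) that in auto)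
  then have "R \<in> sets (F t)" unfolding R_def by auto
  moreover have "dyadic_cell T n k \<inter> space M = L \<inter> R"
    unfolding dyadic_cell_def L_def R_def using filtration_space[OF t] by auto
  ultimately show ?thesis by auto
qed

lemma sets_strict_past:
  "sets (strict_past M F T) = sigma_sets (space M)
     (sets (F 0) \<union> {A \<inter> {\<omega> \<in> space M. ennreal t < T \<omega>} | A t. 0 \<le> t \<and> A \<in> sets (F t)})"
proof -
  have "sets (F 0) \<subseteq> Pow (space M)"
    using sets.space_closed[of "F 0"] filtration_space[of 0] by simp
  then show ?thesis unfolding strict_past_def by (intro sets_measure_of) auto
qed

lemma space_strict_past: "space (strict_past M F T) = space M"
  unfolding strict_past_def by (rule space_measure_of_conv)

lemma strict_past_subalgebra: "subalgebra M (strict_past M F T)"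
proof -
  have "sets (F 0) \<union> {A \<inter> {\<omega> \<in> space M. ennreal t < T \<omega>} | A t. 0 \<le> t \<and> A \<in> sets (F t)} \<subseteq> sets M"
    using filtration_sets stopping_time_gt_sets by blast
  then show ?thesis
    unfolding subalgebra_def sets_strict_past space_strict_past
    using sets.sigma_sets_subset by blast
qed

lemma gt_in_strict_past:
  assumes "0 \<le> t" "A \<in> sets (F t)"
  shows "A \<inter> {\<omega>. ennreal t < T \<omega>} \<in> sets (strict_past M F T)"
proof -
  have "A \<inter> {\<omega>. ennreal t < T \<omega>} = A \<inter> {\<omega> \<in> space M. ennreal t < T \<omega>}"
    using sets.sets_into_space[OF assms(2)] filtration_space[OF assms(1)] by auto
  then show ?thesis unfolding sets_strict_past using assms by (intro sigma_sets.Basic) auto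
qed

text \<open>The set is the difference of \<open>A\<close> with \<open>T\<close> beyond the left end
  and \<open>A\<close> with \<open>T\<close> beyond the right end. Both are generators, as
  \<open>A\<close> also belongs to \<open>F\<close> at the right end. For \<open>k = 0\<close> the
  set \<open>A\<close> in \<open>F 0\<close> is itself a generator.\<close>

lemma Int_dyadic_cell_in_strict_past:
  assumes k: "k \<le> n * 2 ^ n + 1" and A: "A \<in> sets (F (real (k - 1) / 2 ^ n))"
  shows "A \<inter> dyadic_cell T n k \<in> sets (strict_past M F T)"
proof -
  define L where "L = (if 0 < k then A \<inter> {\<omega>. ennreal (real (k - 1) / 2 ^ n) < T \<omega>} else A)"
  define R where "R = (if k \<le> n * 2 ^ n then A \<inter> {\<omega>. ennreal (real k / 2 ^ n) < T \<omega>} else {})"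
  have "A \<in> sets (F (real k / 2 ^ n))"
    using A filtration_mono[of "real (k - 1) / 2 ^ n" "real k / 2 ^ n"]
    by (auto simp: divide_right_mono)
  then have "R \<in> sets (strict_past M F T)" unfolding R_def using gt_in_strict_past by auto
  moreover have "L \<in> sets (strict_past M F T)"
    unfolding L_def using gt_in_strict_past A by (auto simp: sets_strict_past)
  moreover have "A \<inter> dyadic_cell T n k = L - R"
    unfolding dyadic_cell_def L_def R_def by auto
  ultimately show ?thesis by auto
qed

text \<open>The set \<open>A\<close> that represents \<open>B\<close> on the parent cell also
  represents it on the child, and by the order of the left ends it is already in the child's
  \<sigma>-algebra.\<close>

lemma dyadic_past_Suc: "dyadic_past M F T n \<subseteq> dyadic_past M F T (Suc n)"
proof
  fix B assume B: "B \<in> dyadic_past M F T n"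
  have "\<exists>A\<in>sets (F (real (k - 1) / 2 ^ Suc n)). B \<inter> dyadic_cell T (Suc n) k = A \<inter> dyadic_cell T (Suc n) k"
    if k: "k \<le> Suc n * 2 ^ Suc n + 1" for k
  proof -
    obtain j where j: "j \<le> n * 2 ^ n + 1" "dyadic_cell T (Suc n) k \<subseteq> dyadic_cell T n j"
      "real (j - 1) / 2 ^ n \<le> real (k - 1) / 2 ^ Suc n"
      using dyadic_cell_refines[OF k] by metis
    then obtain A where A: "A \<in> sets (F (real (j - 1) / 2 ^ n))"
      "B \<inter> dyadic_cell T n j = A \<inter> dyadic_cell T n j"
      using B unfolding dyadic_past_def by blast
    have "A \<in> sets (F (real (k - 1) / 2 ^ Suc n))"
      using A(1) filtration_mono[OF _ j(3)] by auto
    moreover have "B \<inter> dyadic_cell T (Suc n) k = A \<inter> dyadic_cell T (Suc n) k"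
      using A(2) j(2) by auto
    ultimately show ?thesis by blast
  qed
  then show "B \<in> dyadic_past M F T (Suc n)" using B unfolding dyadic_past_def by blast
qed

lemma dyadic_past_mono: "n \<le> m \<Longrightarrow> dyadic_past M F T n \<subseteq> dyadic_past M F T m"
  by (rule lift_Suc_mono_le[of "dyadic_past M F T"]) (rule dyadic_past_Suc)

lemma dyadic_past_empty: "{} \<in> dyadic_past M F T n"
  unfolding dyadic_past_def by auto

lemma dyadic_past_Un:
  assumes "B \<in> dyadic_past M F T n" "C \<in> dyadic_past M F T n"
  shows "B \<union> C \<in> dyadic_past M F T n"
  unfolding dyadic_past_def
proof (intro CollectI conjI allI impI)
  show "B \<union> C \<in> sets M" using assms unfolding dyadic_past_def by auto
  fix k assume "k \<le> n * 2 ^ n + 1"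
  then obtain A A' where "A \<in> sets (F (real (k - 1) / 2 ^ n))" "A' \<in> sets (F (real (k - 1) / 2 ^ n))"
    "B \<inter> dyadic_cell T n k = A \<inter> dyadic_cell T n k" "C \<inter> dyadic_cell T n k = A' \<inter> dyadic_cell T n k"
    using assms unfolding dyadic_past_def by blast
  then show "\<exists>A\<in>sets (F (real (k - 1) / 2 ^ n)). (B \<union> C) \<inter> dyadic_cell T n k = A \<inter> dyadic_cell T n k"
    by (intro bexI[of _ "A \<union> A'"]) (auto simp: Int_Un_distrib2)
qed

lemma dyadic_past_compl:
  assumes "B \<in> dyadic_past M F T n"
  shows "space M - B \<in> dyadic_past M F T n"
  unfolding dyadic_past_def
proof (intro CollectI conjI allI impI)
  show "space M - B \<in> sets M" using assms unfolding dyadic_past_def by auto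
  fix k assume "k \<le> n * 2 ^ n + 1"
  then obtain A where A: "A \<in> sets (F (real (k - 1) / 2 ^ n))"
    "B \<inter> dyadic_cell T n k = A \<inter> dyadic_cell T n k"
    using assms unfolding dyadic_past_def by blast
  have "(space M - B) \<inter> dyadic_cell T n k = (space M - A) \<inter> dyadic_cell T n k" using A(2) by auto
  moreover have "space M - A \<in> sets (F (real (k - 1) / 2 ^ n))"
    using A(1) filtration_space[of "real (k - 1) / 2 ^ n"] by (metis divide_nonneg_nonneg of_nat_0_le_iff sets.compl_sets zero_le_numeral zero_le_power)
  ultimately show "\<exists>A\<in>sets (F (real (k - 1) / 2 ^ n)). (space M - B) \<inter> dyadic_cell T n k = A \<inter> dyadic_cell T n k"
    by blast
qed

lemma dyadic_past_initial:
  assumes "A \<in> sets (F 0)"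
  shows "A \<in> dyadic_past M F T n"
proof -
  have "A \<in> sets M" "A \<in> sets (F (real (k - 1) / 2 ^ n))" for k
    using assms filtration_sets[of 0] filtration_mono[of 0 "real (k - 1) / 2 ^ n"] by auto
  then show ?thesis unfolding dyadic_past_def by blast
qed

text \<open>Cells with index at most \<open>k\<close> lie in \<open>T \<le> k / 2 ^ n\<close>, so
  the trace is empty. Later cells lie in \<open>T > k / 2 ^ n\<close>, so the trace is that of
  \<open>A\<close>, and their left end is at least \<open>k / 2 ^ n\<close>.\<close>

lemma dyadic_past_gt:
  assumes k: "k \<le> n * 2 ^ n" and A: "A \<in> sets (F (real k / 2 ^ n))"
  shows "A \<inter> {\<omega>. ennreal (real k / 2 ^ n) < T \<omega>} \<in> dyadic_past M F T n" (is "?B \<in> _")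
  unfolding dyadic_past_def
proof (intro CollectI conjI allI impI)
  show "?B \<in> sets M"
    using gt_in_strict_past[OF _ A] strict_past_subalgebra by (auto simp: subalgebra_def)
  fix j assume j: "j \<le> n * 2 ^ n + 1"
  show "\<exists>A\<in>sets (F (real (j - 1) / 2 ^ n)). ?B \<inter> dyadic_cell T n j = A \<inter> dyadic_cell T n j"
  proof (cases "j \<le> k")
    case True
    then have le: "ennreal (real j / 2 ^ n) \<le> ennreal (real k / 2 ^ n)"
      by (intro ennreal_leI divide_right_mono) auto
    have "T \<omega> \<le> ennreal (real j / 2 ^ n)" if "\<omega> \<in> dyadic_cell T n j" for \<omega>
      using that True k unfolding dyadic_cell_def by simp
    then have "?B \<inter> dyadic_cell T n j = {} \<inter> dyadic_cell T n j"
      using order.trans[OF _ le] leD by blast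
    then show ?thesis by blast
  next
    case False
    then have le: "real k / 2 ^ n \<le> real (j - 1) / 2 ^ n"
      by (intro divide_right_mono) auto
    have "ennreal (real (j - 1) / 2 ^ n) < T \<omega>" if "\<omega> \<in> dyadic_cell T n j" for \<omega>
      using that False unfolding dyadic_cell_def by simp
    then have "?B \<inter> dyadic_cell T n j = A \<inter> dyadic_cell T n j"
      using order.strict_trans1[OF ennreal_leI[OF le]] by blast
    moreover have "A \<in> sets (F (real (j - 1) / 2 ^ n))"
      using A filtration_mono[OF _ le] by auto
    ultimately show ?thesis by blast
  qed
qed

text \<open>The event \<open>t < T\<close> is the countable union of the events
  \<open>k / 2 ^ n < T\<close> over grid points \<open>k / 2 ^ n \<ge> t\<close>, and
  \<open>A\<close> in \<open>F t\<close> belongs to \<open>F\<close> at each of these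
  points.\<close>

lemma strict_past_generated_by_dyadic_past:
  "sets (strict_past M F T) \<subseteq> sigma_sets (space M) (\<Union>n. dyadic_past M F T n)"
proof -
  have "A \<inter> {\<omega> \<in> space M. ennreal t < T \<omega>} \<in> sigma_sets (space M) (\<Union>n. dyadic_past M F T n)"
    if t: "0 \<le> t" and A: "A \<in> sets (F t)" for A t
  proof -
    define I where "I = {(n, k). k \<le> n * 2 ^ n \<and> t \<le> real k / 2 ^ n}"
    have "A \<inter> {\<omega> \<in> space M. ennreal t < T \<omega>} = (\<Union>(n, k)\<in>I. A \<inter> {\<omega>. ennreal (real k / 2 ^ n) < T \<omega>})"
    proof (intro equalityI subsetI)
      fix \<omega> assume w: "\<omega> \<in> A \<inter> {\<omega> \<in> space M. ennreal t < T \<omega>}"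
      then obtain r where r: "ennreal t < r" "r < T \<omega>" using dense by blast
      then have "r < top" using top.not_eq_extremum by (metis less_le_trans top_greatest)
      \<comment> \<open>A finite \<open>u\<close> strictly between \<open>t\<close> and
        \<open>T \<omega>\<close> stands in for \<open>T \<omega>\<close>, which may be
        infinite.\<close>
      then obtain u where u: "r = ennreal u" "0 \<le> u" by (cases r) auto
      have tu: "t < u" using r u t by (simp add: ennreal_less_iff)
      obtain N where N: "(1/2) ^ N < u - t" using real_arch_pow_inv[of "u - t" "1/2"] tu by auto
      \<comment> \<open>The level must be fine enough for a grid point between \<open>t\<close> and
        \<open>u\<close>, and high enough for that point, \<open>t\<close> rounded up, to have index
        at most \<open>n * 2 ^ n\<close>.\<close>
      define n where "n = max N (nat \<lceil>t\<rceil> + 1)"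
      define k where "k = nat \<lceil>t * 2 ^ n\<rceil>"
      have k: "t * 2 ^ n \<le> real k" "real k < t * 2 ^ n + 1"
        unfolding k_def using t by (auto simp: of_nat_nat) linarith+
      have n: "t \<le> real n - 1" unfolding n_def using t by linarith
      have "(1/2::real) ^ n \<le> (1/2) ^ N" unfolding n_def by (intro power_decreasing) auto
      then have n2: "1 / 2 ^ n < u - t" using N by (simp add: power_one_over)
      have "t * 2 ^ n + 1 \<le> (t + 1) * 2 ^ n" by (simp add: algebra_simps)
      also have "\<dots> \<le> real n * 2 ^ n" using n by (intro mult_right_mono) auto
      finally have "real k \<le> real (n * 2 ^ n)" using k by simp
      then have "k \<le> n * 2 ^ n" by (simp only: of_nat_le_iff)
      moreover have "t \<le> real k / 2 ^ n" using k by (simp add: field_simps)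
      moreover have "real k / 2 ^ n < u"
      proof -
        have "real k / 2 ^ n < t + 1 / 2 ^ n" using k by (simp add: field_simps)
        then show ?thesis using n2 by simp
      qed
      then have "ennreal (real k / 2 ^ n) < T \<omega>" using r u by (metis ennreal_leI less_imp_le order.strict_trans1)
      ultimately show "\<omega> \<in> (\<Union>(n, k)\<in>I. A \<inter> {\<omega>. ennreal (real k / 2 ^ n) < T \<omega>})"
        using w unfolding I_def by blast
    next
      fix \<omega> assume "\<omega> \<in> (\<Union>(n, k)\<in>I. A \<inter> {\<omega>. ennreal (real k / 2 ^ n) < T \<omega>})"
      then obtain n k where "t \<le> real k / 2 ^ n" "\<omega> \<in> A" "ennreal (real k / 2 ^ n) < T \<omega>"
        unfolding I_def by auto
      then show "\<omega> \<in> A \<inter> {\<omega> \<in> space M. ennreal t < T \<omega>}"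
        using sets.sets_into_space[OF A] filtration_space[OF t]
        by (auto intro: order.strict_trans1[OF ennreal_leI])
    qed
    also have "\<dots> \<in> sigma_sets (space M) (\<Union>n. dyadic_past M F T n)"
    proof (rule sigma_sets_UNION)
      show "countable ((\<lambda>(n, k). A \<inter> {\<omega>. ennreal (real k / 2 ^ n) < T \<omega>}) ` I)" by auto
      fix B assume "B \<in> (\<lambda>(n, k). A \<inter> {\<omega>. ennreal (real k / 2 ^ n) < T \<omega>}) ` I"
      then obtain n k where nk: "k \<le> n * 2 ^ n" "t \<le> real k / 2 ^ n"
        "B = A \<inter> {\<omega>. ennreal (real k / 2 ^ n) < T \<omega>}" unfolding I_def by auto
      have "A \<in> sets (F (real k / 2 ^ n))" using A filtration_mono[OF t nk(2)] by auto
      then show "B \<in> sigma_sets (space M) (\<Union>n. dyadic_past M F T n)"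
        using dyadic_past_gt[OF nk(1)] nk(3) by auto
    qed
    finally show ?thesis .
  qed
  moreover have "A \<in> sigma_sets (space M) (\<Union>n. dyadic_past M F T n)" if "A \<in> sets (F 0)" for A
    using dyadic_past_initial[OF that] by auto
  ultimately show ?thesis unfolding sets_strict_past by (intro sigma_sets_mono) auto
qed

end

end

section \<open>Total variation, double lower limits and absolutely continuous parts\<close>

text \<open>By additivity every finite partition gives the same sum; \<open>{space A}\<close> shows
  that the family of partitions is nonempty.\<close>

lemma total_variation_norm_measure:
  assumes "finite_measure A"
  shows "total_variation_norm A (measure A) = ereal (measure A (space A))"
proof -
  interpret finite_measure A by fact
  let ?\<C> = "{C. finite C \<and> disjoint C \<and> C \<subseteq> sets A \<and> \<Union>C = space A}"
  have "(\<Sum>X\<in>C. \<bar>measure A X\<bar>) = measure A (space A)" if "C \<in> ?\<C>" for C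
    using that finite_measure_finite_Union[of C "\<lambda>X. X"]
    by (auto simp: disjoint_family_on_def disjoint_def)
  then have "total_variation_norm A (measure A) = (SUP C\<in>?\<C>. ereal (measure A (space A)))"
    unfolding total_variation_norm_def by (intro SUP_cong) auto
  moreover have "{space A} \<in> ?\<C>" by auto
  then have "?\<C> \<noteq> {}" by blast
  ultimately show ?thesis using SUP_const[of ?\<C> "ereal (measure A (space A))"] by argo
qed

text \<open>The first condition asks for small values at arbitrarily late positions only. The second
  is uniform in \<open>m\<close>, so \<open>n = 0\<close> serves as the witness in the
  supremum.\<close>

lemma double_liminf_eqI:
  fixes f :: "real \<Rightarrow> nat \<Rightarrow> real"
  assumes U: "\<And>n \<beta> e. 0 < \<beta> \<Longrightarrow> \<beta> < 1 \<Longrightarrow> 0 < e \<Longrightarrow> \<exists>m\<ge>n. \<exists>x\<in>{\<beta>..<1}. f x m \<le> c + e"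
    and L: "\<And>e. 0 < e \<Longrightarrow> \<exists>\<beta>\<in>{0<..<1}. \<forall>x\<in>{\<beta>..<1}. \<forall>m. c - e \<le> f x m"
  shows "double_liminf (\<lambda>x m. ereal (f x m)) = ereal c"
  unfolding double_liminf_def
proof (rule antisym)
  show "(SUP (n, \<beta>)\<in>UNIV \<times> {0<..<1}. INF (m, x)\<in>{n..} \<times> {\<beta>..<1}. ereal (f x m)) \<le> ereal c"
  proof (rule SUP_least, clarify)
    fix n :: nat and \<beta> :: real assume b: "\<beta> \<in> {0<..<1}"
    show "(INF (m, x)\<in>{n..} \<times> {\<beta>..<1}. ereal (f x m)) \<le> ereal c"
    proof (rule ereal_le_epsilon2)
      fix e :: real assume "0 < e"
      then obtain m x where mx: "m \<ge> n" "x \<in> {\<beta>..<1}" "f x m \<le> c + e" using U b by (metis greaterThanLessThan_iff)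
      have "(INF (m, x)\<in>{n..} \<times> {\<beta>..<1}. ereal (f x m)) \<le> ereal (f x m)"
        using mx by (intro INF_lower2[of "(m, x)"]) auto
      also have "\<dots> \<le> ereal c + ereal e" using mx by simp
      finally show "(INF (m, x)\<in>{n..} \<times> {\<beta>..<1}. ereal (f x m)) \<le> ereal c + ereal e" .
    qed
  qed
  show "ereal c \<le> (SUP (n, \<beta>)\<in>UNIV \<times> {0<..<1}. INF (m, x)\<in>{n..} \<times> {\<beta>..<1}. ereal (f x m))" (is "_ \<le> ?S")
  proof (rule ereal_le_epsilon2)
    fix e :: real assume "0 < e"
    then obtain \<beta> where b: "\<beta> \<in> {0<..<1}" "\<forall>x\<in>{\<beta>..<1}. \<forall>m. c - e \<le> f x m" using L by blast
    have "ereal (c - e) \<le> ?S"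
      using b by (intro SUP_upper2[of "(0, \<beta>)"]) (auto intro!: INF_greatest)
    then have "ereal (c - e) + ereal e \<le> ?S + ereal e" by (rule add_right_mono)
    then show "ereal c \<le> ?S + ereal e" by simp
  qed
qed

text \<open>The singular part is carried by an \<open>N\<close>-null set \<open>Z\<close>, on which
  the absolutely continuous part has no mass; off \<open>Z\<close> only the latter is left.\<close>

lemma ac_part_eq_off_null_set:
  assumes "finite_measure M" "sets N = sets M"
  obtains Z where "Z \<in> null_sets N" "sets (ac_part N M) = sets M" "absolutely_continuous N (ac_part N M)"
    "\<And>X. X \<in> sets M \<Longrightarrow> emeasure (ac_part N M) X = emeasure M (X - Z)"
proof -
  let ?A = "ac_part N M"
  obtain S where "lebesgue_decomposition N M ?A S"
    using lebesgue_decomposition_ac_part[OF assms] by blast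
  then have D: "sets ?A = sets M" "sets S = sets M" "absolutely_continuous N ?A"
    "\<And>X. X \<in> sets M \<Longrightarrow> emeasure M X = emeasure ?A X + emeasure S X"
    and "mutually_singular N S"
    by (auto simp: lebesgue_decomposition_def)
  then obtain Z where Z: "Z \<in> null_sets N" "space S - Z \<in> null_sets S"
    by (auto simp: mutually_singular_def)
  have "emeasure ?A X = emeasure M (X - Z)" if X: "X \<in> sets M" for X
  proof -
    have XZ: "X - Z \<in> sets M" using X Z(1) assms(2) by auto
    have "X - Z \<subseteq> space S - Z"
      using sets.sets_into_space[OF X] sets_eq_imp_space_eq[OF D(2)] by auto
    then have "emeasure S (X - Z) = 0"
      using Z(2) XZ D(2) by (metis null_setsD1 null_sets_subset)
    moreover have "Z \<in> null_sets ?A" using D(3) Z(1) by (auto simp: absolutely_continuous_def)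
    then have "emeasure ?A (X - Z) = emeasure ?A X"
      using X D(1) by (simp add: emeasure_Diff_null_set)
    ultimately show ?thesis using D(4)[OF XZ] by simp
  qed
  then show ?thesis using that Z(1) D by blast
qed

text \<open>Truncation of the Radon-Nikodym density: where it is at most \<open>i\<close>, the
  measure \<open>A\<close> is at most \<open>i\<close> times \<open>N\<close>, and these sets
  exhaust \<open>A\<close> because an integrable density is finite almost everywhere.\<close>

lemma absolutely_continuous_bounded_part:
  assumes "finite_measure A" "finite_measure N" and ac: "absolutely_continuous N A"
    and sets: "sets A = sets N" and e: "0 < e"
  obtains K B where "1 \<le> K" "B \<in> sets N" "measure A (space N) - e < measure A B"
    "\<And>X. X \<in> sets N \<Longrightarrow> measure A (X \<inter> B) \<le> K * measure N X"
proof -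
  interpret A: finite_measure A by fact
  interpret N: finite_measure N by fact
  have sp: "space A = space N" using sets by (rule sets_eq_imp_space_eq)
  obtain f where f [measurable]: "f \<in> borel_measurable N" and dens: "density N f = A"
    using N.Radon_Nikodym[OF ac sets] by blast
  define B where "B i = {\<omega> \<in> space N. f \<omega> \<le> of_nat i}" for i :: nat
  have B [measurable]: "B i \<in> sets N" for i unfolding B_def by measurable
  have "(\<integral>\<^sup>+\<omega>. f \<omega> \<partial>N) = emeasure A (space A)"
    unfolding dens[symmetric] by (simp add: emeasure_density cong: nn_integral_cong)
  then have "(\<integral>\<^sup>+\<omega>. f \<omega> \<partial>N) \<noteq> \<infinity>" by simp
  then have "AE \<omega> in N. f \<omega> \<noteq> \<infinity>" by (rule nn_integral_noteq_infinite[OF f])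
  then have fin: "AE \<omega> in A. f \<omega> \<noteq> \<infinity>"
    by (rule absolutely_continuous_AE[OF sets ac])
  have "(\<lambda>i. measure A (B i)) \<longlonglongrightarrow> measure A (\<Union>i. B i)"
  proof (rule A.finite_Lim_measure_incseq)
    show "range B \<subseteq> sets A" unfolding sets using B by blast
    show "incseq B"
      unfolding B_def incseq_def using order_trans[OF _ of_nat_mono[where 'a = ennreal]] by blast
  qed
  moreover have "measure A (\<Union>i. B i) = measure A (space N)"
  proof (rule A.finite_measure_eq_AE)
    show "AE x in A. (x \<in> (\<Union>i. B i)) = (x \<in> space N)"
      using fin AE_space
    proof eventually_elim
      case (elim \<omega>)
      then obtain i :: nat where "f \<omega> < of_nat i" using ennreal_Ex_less_of_nat[of "f \<omega>"] by (auto simp: less_top)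
      then show ?case using elim sp unfolding B_def by (auto intro: less_imp_le)
    qed
  qed (use B sets in auto)
  ultimately have lim: "(\<lambda>i. measure A (B i)) \<longlonglongrightarrow> measure A (space N)" by simp
  have "eventually (\<lambda>i. measure A (space N) - e < measure A (B i)) sequentially"
    using e by (intro order_tendstoD(1)[OF lim]) simp
  then obtain i where i: "1 \<le> i" "measure A (space N) - e < measure A (B i)"
    by (metis (mono_tags, lifting) eventually_sequentially le_cases)
  have "measure A (X \<inter> B i) \<le> real i * measure N X" if X [measurable]: "X \<in> sets N" for X
  proof -
    have "emeasure A (X \<inter> B i) = (\<integral>\<^sup>+\<omega>. f \<omega> * indicator (X \<inter> B i) \<omega> \<partial>N)"
      unfolding dens[symmetric] by (simp add: emeasure_density)
    also have "\<dots> \<le> (\<integral>\<^sup>+\<omega>. of_nat i * indicator X \<omega> \<partial>N)"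
      by (intro nn_integral_mono) (auto simp: B_def indicator_def)
    also have "\<dots> = of_nat i * emeasure N X" by (simp add: nn_integral_cmult_indicator)
    finally show ?thesis
      by (simp add: A.emeasure_eq_measure N.emeasure_eq_measure ennreal_of_nat_eq_real_of_nat flip: ennreal_mult)
  qed
  then show ?thesis using that[of "real i" "B i"] i B by auto
qed

section \<open>The representation of the absolutely continuous part\<close>

lemma measure_restr_to_subalg:
  "subalgebra M F \<Longrightarrow> A \<in> sets F \<Longrightarrow> measure (restr_to_subalg M F) A = measure M A"
  by (simp add: measure_def emeasure_restr_to_subalg)

lemma sum_measure_dyadic_cell:
  assumes "finite_measure \<mu>" and "\<And>k. k \<le> n * 2 ^ n + 1 \<Longrightarrow> B \<inter> dyadic_cell T n k \<in> sets \<mu>"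
  shows "(\<Sum>k\<le>n * 2 ^ n + 1. measure \<mu> (B \<inter> dyadic_cell T n k)) = measure \<mu> B"
proof -
  interpret finite_measure \<mu> by fact
  have "measure \<mu> (\<Union>k\<le>n * 2 ^ n + 1. B \<inter> dyadic_cell T n k)
    = (\<Sum>k\<le>n * 2 ^ n + 1. measure \<mu> (B \<inter> dyadic_cell T n k))"
    by (rule finite_measure_finite_Union)
       (use assms(2) disjoint_family_dyadic_cell[of T n] in \<open>auto simp: disjoint_family_on_def\<close>)
  moreover have "(\<Union>k\<le>n * 2 ^ n + 1. B \<inter> dyadic_cell T n k) = B"
    using Union_dyadic_cell[of T n] by (metis Int_UN_distrib Int_UNIV_right)
  ultimately show ?thesis by simp
qed

text \<open>The cell densities enter only through \<open>density_on\<close>, so that plain densities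
  on the outer cells and conditional expectations on the middle cells are treated alike.\<close>

lemma ac_part_strict_past_eq_double_liminf:
  fixes g g' :: "nat \<Rightarrow> nat \<Rightarrow> 'a \<Rightarrow> real"
  assumes F: "filtered_space M F" and T: "ext_stopping_time F T" and P: "sets P = sets M"
    and \<mu>: "prob_space \<mu>" "sets \<mu> = sets M" and \<nu>: "prob_space \<nu>" "sets \<nu> = sets M"
    and g: "\<And>n k. k \<le> n * 2 ^ n + 1 \<Longrightarrow>
      density_on (restr_to_subalg P (F (real (k - 1) / 2 ^ n))) \<mu> (dyadic_cell T n k) (g n k)"
    and g': "\<And>n k. k \<le> n * 2 ^ n + 1 \<Longrightarrow>
      density_on (restr_to_subalg P (F (real (k - 1) / 2 ^ n))) \<nu> (dyadic_cell T n k) (g' n k)"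
  defines "\<mu>a \<equiv> ac_part (restr_to_subalg \<nu> (strict_past M F T)) (restr_to_subalg \<mu> (strict_past M F T))"
  shows "total_variation_norm \<mu>a (measure \<mu>a) = double_liminf (\<lambda>x n. ereal (\<Sum>k\<le>n * 2 ^ n + 1.
    \<integral>\<omega>. g n k \<omega> powr x * g' n k \<omega> powr (1 - x) \<partial>restr_to_subalg P (F (real (k - 1) / 2 ^ n))))"
proof -

  \<comment> \<open>The absolutely continuous part as \<open>\<mu>\<close> off a null set\<close>
  interpret \<mu>: prob_space \<mu> by fact
  interpret \<nu>: prob_space \<nu> by fact
  let ?S = "strict_past M F T" and ?c = "dyadic_cell T"
  have sp: "space \<mu> = space M" "space \<nu> = space M" "space P = space M"
    using \<mu> \<nu> P by (auto dest: sets_eq_imp_space_eq)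
  note S = strict_past_subalgebra[OF F T]
  have S\<mu>: "subalgebra \<mu> ?S" and S\<nu>: "subalgebra \<nu> ?S"
    using S \<mu> \<nu> sp by (auto simp: subalgebra_def)
  have spS: "space ?S = space M" and SM: "sets ?S \<subseteq> sets M" using S by (auto simp: subalgebra_def)
  let ?\<mu>S = "restr_to_subalg \<mu> ?S" and ?\<nu>S = "restr_to_subalg \<nu> ?S"
  have sets\<mu>S: "sets ?\<mu>S = sets ?S" and sets\<nu>S: "sets ?\<nu>S = sets ?S"
    by (simp_all add: sets_restr_to_subalg S\<mu> S\<nu>)
  have fin\<mu>S: "finite_measure ?\<mu>S" and fin\<nu>S: "finite_measure ?\<nu>S"
    using finite_measure_restr_to_subalg S\<mu> S\<nu> \<mu>.finite_measure_axioms \<nu>.finite_measure_axioms by blast+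
  have "sets ?\<nu>S = sets ?\<mu>S" by (simp add: sets\<mu>S sets\<nu>S)
  from ac_part_eq_off_null_set[OF fin\<mu>S this] obtain Z where
    Z: "Z \<in> null_sets ?\<nu>S" and sets_a: "sets \<mu>a = sets ?S" and ac: "absolutely_continuous ?\<nu>S \<mu>a"
    and em_a: "\<And>X. X \<in> sets ?S \<Longrightarrow> emeasure \<mu>a X = emeasure ?\<mu>S (X - Z)"
    unfolding \<mu>a_def sets\<mu>S by blast
  have ZS: "Z \<in> sets ?S" and Z0: "measure \<nu> Z = 0"
    using Z S\<nu> by (auto simp: null_sets_restr_to_subalg measure_def)
  have m_a: "measure \<mu>a X = measure \<mu> (X - Z)" if "X \<in> sets ?S" for X
    using em_a[OF that] that ZS S\<mu> by (simp add: measure_def emeasure_restr_to_subalg)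
  have sp_a: "space \<mu>a = space M" using sets_eq_imp_space_eq[OF sets_a] spS by simp
  have topS: "space M \<in> sets ?S" using spS by (metis sets.top)
  have fin_a: "finite_measure \<mu>a"
  proof (rule finite_measureI)
    have "emeasure \<mu>a (space \<mu>a) = emeasure ?\<mu>S (space M - Z)" using em_a topS sp_a by simp
    then show "emeasure \<mu>a (space \<mu>a) \<noteq> \<infinity>" using fin\<mu>S by (simp add: finite_measure.emeasure_finite)
  qed
  define c where "c = measure \<mu>a (space M)"
  have c: "c = measure \<mu> (space M - Z)" unfolding c_def using m_a topS by simp
  let ?N = "\<lambda>n k. restr_to_subalg P (F (real (k - 1) / 2 ^ n))"
  have spN: "space (?N n k) = space M" for n k by (simp add: space_restr_to_subalg sp)
  have setsN: "sets (?N n k) = sets (F (real (k - 1) / 2 ^ n))" for n k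
  proof (rule sets_restr_to_subalg)
    have "subalgebra M (F (real (k - 1) / 2 ^ n))" by (rule filtration_subalgebra[OF F]) simp
    then show "subalgebra P (F (real (k - 1) / 2 ^ n))" using P sp by (simp add: subalgebra_def)
  qed
  have cellS: "A \<inter> ?c n k \<in> sets ?S" if "k \<le> n * 2 ^ n + 1" "A \<in> sets (?N n k)" for A n k
    using Int_dyadic_cell_in_strict_past[OF F T that(1)] that(2) setsN by simp
  define h where "h x n = (\<Sum>k\<le>n * 2 ^ n + 1. \<integral>\<omega>. g n k \<omega> powr x * g' n k \<omega> powr (1 - x) \<partial>?N n k)" for x n

  \<comment> \<open>Upper bound at arbitrarily late positions\<close>
  have upper: "\<exists>m\<ge>n. \<exists>x\<in>{\<beta>..<1}. h x m \<le> c + e" if b: "0 < \<beta>" "\<beta> < 1" and e: "0 < e" for n \<beta> e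
  proof -
    \<comment> \<open>The exponent is fixed first and \<open>d\<close> chosen afterwards. The final
      error \<open>2 * d powr (1 - x) + d + (1 - x)\<close> then consists of four quarters of
      \<open>e\<close>.\<close>
    define x where "x = max \<beta> (1 - e / 4)"
    have x: "0 < x" "x < 1" "\<beta> \<le> x" "1 - x \<le> e / 4" using b e unfolding x_def by (auto simp: max_def)
    define d where "d = min (e / 4) ((e / 4) powr (1 / (1 - x)))"
    have d: "0 < d" "d \<le> e / 4" using e by (auto simp: d_def)
    have "d powr (1 - x) \<le> ((e / 4) powr (1 / (1 - x))) powr (1 - x)"
      using x d by (intro powr_mono2) (auto simp: d_def)
    also have "\<dots> = e / 4" using x e by (simp add: powr_powr)
    finally have dx: "d powr (1 - x) \<le> e / 4" .
    have "\<exists>n. \<exists>B\<in>dyadic_past M F T n. measure \<mu> (sym_diff Z B) + measure \<nu> (sym_diff Z B) < d"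
    proof (rule sigma_sets_approx_two_measures)
      show "Z \<in> sigma_sets (space \<mu>) (\<Union>n. dyadic_past M F T n)"
        using strict_past_generated_by_dyadic_past[OF F T] ZS sp by auto
    qed (use dyadic_past_empty[OF F T] dyadic_past_compl[OF F T] dyadic_past_Un[OF F T]
        dyadic_past_mono[OF F T] \<mu> \<nu> sp d \<mu>.finite_measure_axioms \<nu>.finite_measure_axioms
        in \<open>auto simp: dyadic_past_def\<close>)
    then obtain n0 B where B0: "B \<in> dyadic_past M F T n0"
      and Bd: "measure \<mu> (sym_diff Z B) + measure \<nu> (sym_diff Z B) < d" by blast
    \<comment> \<open>The level \<open>n0\<close> of the approximation is not under control; since
      the algebras increase, \<open>B\<close> stays available at a level beyond
      \<open>n\<close>.\<close>
    define m where "m = max n n0"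
    have B: "B \<in> dyadic_past M F T m" using dyadic_past_mono[OF F T, of n0 m] B0 by (auto simp: m_def)
    have BM: "B \<in> sets M" "Z \<in> sets M" using B ZS SM by (auto simp: dyadic_past_def)
    let ?C = "space M - B"
    have cells: "X \<inter> ?c m k \<in> sets M" if "X \<in> sets M" "k \<le> m * 2 ^ m + 1" for X k
    proof -
      have "space M \<inter> ?c m k \<in> sets M" using cellS[OF that(2), of "space (?N m k)"] spN SM by auto
      then have "X \<inter> (space M \<inter> ?c m k) \<in> sets M" using that by auto
      then show ?thesis using sets.sets_into_space[OF that(1)] by (metis Int_absorb2 Int_assoc)
    qed
    have "h x m \<le> (\<Sum>k\<le>m * 2 ^ m + 1.
      d powr (1 - x) * (measure \<mu> (B \<inter> ?c m k) + measure \<nu> (B \<inter> ?c m k) / d)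
      + (measure \<mu> (?C \<inter> ?c m k) + (1 - x) * measure \<nu> (?C \<inter> ?c m k)))"
      unfolding h_def
    proof (rule sum_mono)
      fix k assume "k \<in> {..m * 2 ^ m + 1}"
      then have k: "k \<le> m * 2 ^ m + 1" by simp
      \<comment> \<open>On this cell \<open>B\<close> is replaced by a set of the left-end
        \<sigma>-algebra, as \<open>hellinger_le\<close> demands.\<close>
      then obtain A where A: "A \<in> sets (F (real (k - 1) / 2 ^ m))" "B \<inter> ?c m k = A \<inter> ?c m k"
        using B unfolding dyadic_past_def by blast
      have "?C \<inter> ?c m k = (space M - A) \<inter> ?c m k" using A(2) by auto
      then show "(\<integral>\<omega>. g m k \<omega> powr x * g' m k \<omega> powr (1 - x) \<partial>?N m k) \<le>
        d powr (1 - x) * (measure \<mu> (B \<inter> ?c m k) + measure \<nu> (B \<inter> ?c m k) / d)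
        + (measure \<mu> (?C \<inter> ?c m k) + (1 - x) * measure \<nu> (?C \<inter> ?c m k))"
        using hellinger_le[OF g[OF k] g'[OF k] _ x(1,2) d(1), of A] A setsN spN by simp
    qed
    also have "\<dots> = d powr (1 - x) * (measure \<mu> B + measure \<nu> B / d) + (measure \<mu> ?C + (1 - x) * measure \<nu> ?C)"
    proof -
      have "(\<Sum>k\<le>m * 2 ^ m + 1. measure \<rho> (X \<inter> ?c m k)) = measure \<rho> X"
        if "finite_measure \<rho>" "sets \<rho> = sets M" "X \<in> sets M" for \<rho> X
        using that cells by (intro sum_measure_dyadic_cell) auto
      note * = this[OF \<mu>.finite_measure_axioms \<mu>(2)] this[OF \<nu>.finite_measure_axioms \<nu>(2)]
      have "?C \<in> sets M" using BM by auto
      with BM show ?thesis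
        by (simp only: sum.distrib * flip: sum_distrib_left sum_divide_distrib)
    qed
    also have "\<dots> \<le> d powr (1 - x) * 2 + (c + d + (1 - x))"
    proof (intro add_mono mult_left_mono)
      \<comment> \<open>As \<open>Z\<close> is \<open>\<nu>\<close>-null, \<open>B\<close> has
        \<open>\<nu>\<close>-mass at most \<open>d\<close>, which compensates the division by
        \<open>d\<close>.\<close>
      have "measure \<nu> B \<le> measure \<nu> (Z \<union> sym_diff Z B)"
        using BM \<nu> by (intro \<nu>.finite_measure_mono) auto
      also have "\<dots> \<le> measure \<nu> Z + measure \<nu> (sym_diff Z B)"
        using BM \<nu> by (intro measure_Un_le) auto
      also have "\<dots> \<le> d" using Bd Z0 measure_nonneg[of \<mu> "sym_diff Z B"] by linarith
      finally have "measure \<nu> B / d \<le> 1" using d by simp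
      then show "measure \<mu> B + measure \<nu> B / d \<le> 2" using \<mu>.prob_le_1[of B] by linarith
      have "measure \<mu> ?C \<le> measure \<mu> ((space M - Z) \<union> sym_diff Z B)"
        using BM \<mu> by (intro \<mu>.finite_measure_mono) auto
      also have "\<dots> \<le> measure \<mu> (space M - Z) + measure \<mu> (sym_diff Z B)"
        using BM \<mu> by (intro measure_Un_le) auto
      also have "\<dots> \<le> c + d" using Bd c measure_nonneg[of \<nu> "sym_diff Z B"] by linarith
      finally show "measure \<mu> ?C \<le> c + d" .
      show "(1 - x) * measure \<nu> ?C \<le> 1 - x" using x by (simp add: mult_left_le)
    qed simp
    also have "\<dots> \<le> c + e" using dx d x by simp
    finally have "h x m \<le> c + e" .
    moreover have "m \<ge> n" "x \<in> {\<beta>..<1}" using x by (auto simp: m_def)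
    ultimately show ?thesis by blast
  qed

  \<comment> \<open>Lower bound, uniform in the level\<close>
  have lower: "\<exists>\<beta>\<in>{0<..<1}. \<forall>x\<in>{\<beta>..<1}. \<forall>m. c - e \<le> h x m" if e: "0 < e" for e
  proof -
    have e2: "0 < e / 2" using e by simp
    have sets_a': "sets \<mu>a = sets ?\<nu>S" using sets_a sets\<nu>S by simp
    obtain K B where K: "1 \<le> K" and B: "B \<in> sets ?S" and cB: "c - e / 2 < measure \<mu>a B"
      and KB: "\<And>X. X \<in> sets ?S \<Longrightarrow> measure \<mu>a (X \<inter> B) \<le> K * measure \<nu> X"
    proof (rule absolutely_continuous_bounded_part[OF fin_a fin\<nu>S ac sets_a' e2])
      fix K B
      assume *: "1 \<le> K" "B \<in> sets ?\<nu>S" "measure \<mu>a (space ?\<nu>S) - e / 2 < measure \<mu>a B"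
        "\<And>X. X \<in> sets ?\<nu>S \<Longrightarrow> measure \<mu>a (X \<inter> B) \<le> K * measure ?\<nu>S X"
      show thesis
      proof (rule that[OF *(1)])
        show "B \<in> sets ?S" using *(2) sets\<nu>S by simp
        show "c - e / 2 < measure \<mu>a B" using *(3) by (simp add: c_def space_restr_to_subalg sp)
        show "measure \<mu>a (X \<inter> B) \<le> K * measure \<nu> X" if "X \<in> sets ?S" for X
          using *(4)[of X] that S\<nu> sets\<nu>S by (simp add: measure_restr_to_subalg)
      qed
    qed
    interpret a: finite_measure \<mu>a by fact
    \<comment> \<open>This is the bounded part \<lambda> of \<open>\<mu>a\<close>: it lies below
      \<open>\<mu>\<close> by \<open>m_a\<close> and below \<open>K\<close> times
      \<open>\<nu>\<close> by \<open>KB\<close>.\<close>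
    define l where "l X = measure \<mu>a (X \<inter> B)" for X
    have bound: "K powr (x - 1) * measure \<mu>a B \<le> h x m" if x: "0 < x" "x < 1" for x m
    proof -
      have "K powr (x - 1) * measure \<mu>a B = (\<Sum>k\<le>m * 2 ^ m + 1. K powr (x - 1) * l (space (?N m k) \<inter> ?c m k))"
      proof -
        have BM: "B \<subseteq> space M" using sets.sets_into_space[OF B] spS by simp
        have eq: "space M \<inter> ?c m k \<inter> B = B \<inter> ?c m k" for k using BM by auto
        have "B \<inter> ?c m k \<in> sets \<mu>a" if "k \<le> m * 2 ^ m + 1" for k
        proof -
          have "space M \<inter> ?c m k \<in> sets ?S" using cellS[OF that, of "space (?N m k)"] unfolding spN
            by (metis sets.top spN)
          then show ?thesis using B unfolding eq[symmetric] sets_a by blast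
        qed
        then have "measure \<mu>a B = (\<Sum>k\<le>m * 2 ^ m + 1. measure \<mu>a (B \<inter> ?c m k))"
          by (intro sum_measure_dyadic_cell[symmetric] fin_a)
        then show ?thesis unfolding l_def spN eq by (simp only: sum_distrib_left)
      qed
      also have "\<dots> \<le> h x m"
        unfolding h_def
      proof (rule sum_mono)
        fix k assume "k \<in> {..m * 2 ^ m + 1}"
        then have k: "k \<le> m * 2 ^ m + 1" by simp
        show "K powr (x - 1) * l (space (?N m k) \<inter> ?c m k)
          \<le> (\<integral>\<omega>. g m k \<omega> powr x * g' m k \<omega> powr (1 - x) \<partial>?N m k)"
        proof (rule hellinger_ge[OF g[OF k] g'[OF k] x])
          show "0 < K" using K by simp
          fix A assume A: "A \<in> sets (?N m k)"
          note AS = cellS[OF k A]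
          have CS: "(space (?N m k) - A) \<inter> ?c m k \<in> sets ?S" using A by (intro cellS[OF k]) auto
          have "l (A \<inter> ?c m k) = measure \<mu> (A \<inter> ?c m k \<inter> B - Z)"
            unfolding l_def using AS B by (intro m_a) auto
          also have "\<dots> \<le> measure \<mu> (A \<inter> ?c m k)"
            using AS SM \<mu> by (intro \<mu>.finite_measure_mono) auto
          finally show "l (A \<inter> ?c m k) \<le> measure \<mu> (A \<inter> ?c m k)" .
          show "l (A \<inter> ?c m k) \<le> K * measure \<nu> (A \<inter> ?c m k)"
            unfolding l_def using KB[OF AS] .
          have "l (space (?N m k) \<inter> ?c m k) \<le> measure \<mu>a ((A \<inter> ?c m k \<inter> B) \<union> ((space (?N m k) - A) \<inter> ?c m k \<inter> B))"
            unfolding l_def using AS CS B sets_a by (intro a.finite_measure_mono) auto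
          also have "\<dots> \<le> l (A \<inter> ?c m k) + l ((space (?N m k) - A) \<inter> ?c m k)"
            unfolding l_def using AS CS B sets_a by (intro measure_Un_le) auto
          finally show "l (space (?N m k) \<inter> ?c m k) \<le> l (A \<inter> ?c m k) + l ((space (?N m k) - A) \<inter> ?c m k)" .
        qed
      qed
      finally show ?thesis .
    qed
    \<comment> \<open>Since \<open>K\<close> is already fixed and independent of \<open>m\<close>,
      the factor tends to 1 at a rate independent of the level.\<close>
    have "((\<lambda>x. K powr (x - 1)) \<longlongrightarrow> K powr (1 - 1)) (at_left 1)"
      using K by (intro tendsto_intros) auto
    then have "eventually (\<lambda>x. 1 - e / 2 < K powr (x - 1)) (at_left 1)"
      using e K by (intro order_tendstoD(1)) auto
    then obtain b where b: "b < 1" "\<And>x. b < x \<Longrightarrow> x < 1 \<Longrightarrow> 1 - e / 2 < K powr (x - 1)"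
      unfolding eventually_at_left_field by blast
    \<comment> \<open>The midpoint of \<open>b\<close> and 1 lies strictly between them;
      \<open>1 / 2\<close> guards against a negative \<open>b\<close>.\<close>
    define \<beta> where "\<beta> = max (1 / 2) ((b + 1) / 2)"
    have \<beta>: "0 < \<beta>" "\<beta> < 1" "b < \<beta>" using b by (auto simp: \<beta>_def max_def)
    have "c - e \<le> h x m" if x: "x \<in> {\<beta>..<1}" for x m
    proof -
      have Bc: "measure \<mu>a B \<le> 1"
        using m_a[OF B] by simp
      \<comment> \<open>As \<open>\<mu>a\<close> has mass at most 1, the factor
        \<open>1 - e / 2\<close> costs at most \<open>e / 2\<close>; the other half of
        \<open>e\<close> was spent on passing to \<open>B\<close>.\<close>
      have "measure \<mu>a B - e / 2 \<le> measure \<mu>a B - e / 2 * measure \<mu>a B"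
        using Bc e by (simp add: mult_left_le)
      also have "\<dots> = (1 - e / 2) * measure \<mu>a B" by (simp add: algebra_simps)
      also have "\<dots> \<le> K powr (x - 1) * measure \<mu>a B"
        using b(2)[of x] x \<beta> by (intro mult_right_mono) auto
      also have "\<dots> \<le> h x m" using x \<beta> by (intro bound) auto
      finally show ?thesis using cB by linarith
    qed
    then show ?thesis using \<beta> by (intro bexI[of _ \<beta>]) auto
  qed
  have "double_liminf (\<lambda>x n. ereal (h x n)) = ereal c"
    by (rule double_liminf_eqI[OF upper lower])
  then show ?thesis
    using total_variation_norm_measure[OF fin_a] by (simp add: h_def c_def sp_a)
qed

theorem theorem3:
  fixes M P \<mu> \<nu> :: "'a measure"
    and F :: "real \<Rightarrow> 'a measure"
    and z z' :: "real \<Rightarrow> 'a \<Rightarrow> real"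
    and T :: "'a \<Rightarrow> ennreal"
  assumes "filtered_space M F"
    and "right_continuous_filtration F"
    and "generated_by_filtration M F"
    and "prob_space P" "sets P = sets M"
    and "prob_space \<mu>" "sets \<mu> = sets M"
    and "prob_space \<nu>" "sets \<nu> = sets M"
    and "locally_absolutely_continuous F P \<mu>"
    and "locally_absolutely_continuous F P \<nu>"
    and "density_process F P \<mu> z"
    and "density_process F P \<nu> z'"
    and "ext_stopping_time F T"
  shows "let \<mu>a = ac_part (restr_to_subalg \<nu> (strict_past M F T)) (restr_to_subalg \<mu> (strict_past M F T))
    in total_variation_norm \<mu>a (measure \<mu>a) =
    double_liminf (\<lambda>\<alpha> n. ereal (
      (\<integral>\<omega>. z 0 \<omega> powr \<alpha> * z' 0 \<omega> powr (1 - \<alpha>) * indicator {\<omega>. T \<omega> = 0} \<omega>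
         \<partial>restr_to_subalg P (F 0))
      + (\<integral>\<omega>. z (real n) \<omega> powr \<alpha> * z' (real n) \<omega> powr (1 - \<alpha>) * indicator {\<omega>. ennreal (real n) < T \<omega>} \<omega>
           \<partial>restr_to_subalg P (F (real n)))
      + (\<Sum>k = 1..n * 2 ^ n.
           let s = (real k - 1) / 2 ^ n;
               t = real k / 2 ^ n;
               D = {\<omega>. ennreal s < T \<omega> \<and> T \<omega> \<le> ennreal t}
           in \<integral>\<omega>. real_cond_exp P (F s) (\<lambda>\<omega>. z t \<omega> * indicator D \<omega>) \<omega> powr \<alpha>
                 * real_cond_exp P (F s) (\<lambda>\<omega>. z' t \<omega> * indicator D \<omega>) \<omega> powr (1 - \<alpha>)
                \<partial>restr_to_subalg P (F s))))"
proof -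

  \<comment> \<open>Identification of the cell densities and of the three kinds of integrals\<close>
  note F = assms(1) and T = assms(14)
  let ?c = "dyadic_cell T"
  \<comment> \<open>The second branch covers \<open>k = 0\<close> and
    \<open>k = n * 2 ^ n + 1\<close>, where \<open>(k - 1) / 2 ^ n\<close> is 0 and \<open>n\<close>
    and the cell is already decided at that time.\<close>
  define g where "g z n k = (if 1 \<le> k \<and> k \<le> n * 2 ^ n
    then real_cond_exp P (F (real (k - 1) / 2 ^ n)) (\<lambda>\<omega>. z (real k / 2 ^ n) \<omega> * indicator (?c n k) \<omega>)
    else (\<lambda>\<omega>. z (real (k - 1) / 2 ^ n) \<omega> * indicator (?c n k) \<omega>))"
    for z :: "real \<Rightarrow> 'a \<Rightarrow> real" and n k
  have fin: "finite_measure P" using assms(4) by (rule prob_space.finite_measure)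
  have sp: "space P = space M" using assms(5) by (rule sets_eq_imp_space_eq)
  have sub: "subalgebra P (F t)" if "0 \<le> t" for t
    using filtration_subalgebra[OF F that] assms(5) sp by (simp add: subalgebra_def)
  have dens: "density_on (restr_to_subalg P (F (real (k - 1) / 2 ^ n))) \<rho> (?c n k) (g y n k)"
    if \<rho>: "prob_space \<rho>" "sets \<rho> = sets M" "density_process F P \<rho> y" and k: "k \<le> n * 2 ^ n + 1" for \<rho> y n k
  proof -
    have fin\<rho>: "finite_measure \<rho>" using \<rho>(1) by (rule prob_space.finite_measure)
    have sets\<rho>: "sets \<rho> = sets P" using \<rho>(2) assms(5) by simp
    have y: "y t \<in> borel_measurable (F t)" "\<And>\<omega>. \<omega> \<in> space P \<Longrightarrow> 0 \<le> y t \<omega>"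
      "restr_to_subalg \<rho> (F t) = density (restr_to_subalg P (F t)) (\<lambda>\<omega>. ennreal (y t \<omega>))"
      if "0 \<le> t" for t
      using \<rho>(3) that unfolding density_process_def by auto
    show ?thesis
    proof (cases "1 \<le> k \<and> k \<le> n * 2 ^ n")
      case True
      have "density_on (restr_to_subalg P (F (real (k - 1) / 2 ^ n))) \<rho> (?c n k)
        (real_cond_exp P (F (real (k - 1) / 2 ^ n)) (\<lambda>\<omega>. y (real k / 2 ^ n) \<omega> * indicator (?c n k) \<omega>))"
      proof (rule density_on_real_cond_exp[OF sub sub _ fin fin\<rho> sets\<rho> y])
        show "sets (F (real (k - 1) / 2 ^ n)) \<subseteq> sets (F (real k / 2 ^ n))"
          by (rule filtration_mono[OF F]) (auto intro: divide_right_mono)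
        show "?c n k \<inter> space P \<in> sets (F (real k / 2 ^ n))"
          unfolding sp using True by (intro dyadic_cell_sets[OF F T k]) auto
      qed auto
      then show ?thesis using True by (simp add: g_def)
    next
      case False
      have "density_on (restr_to_subalg P (F (real (k - 1) / 2 ^ n))) \<rho> (?c n k)
        (\<lambda>\<omega>. y (real (k - 1) / 2 ^ n) \<omega> * indicator (?c n k) \<omega>)"
      proof (rule density_on_indicator[OF sub fin\<rho> sets\<rho> y])
        have "k = 0 \<or> k = n * 2 ^ n + 1" using False k by auto
        then show "?c n k \<inter> space P \<in> sets (F (real (k - 1) / 2 ^ n))"
          unfolding sp by (intro dyadic_cell_sets[OF F T k]) auto
      qed auto
      then show ?thesis using False by (simp only: g_def if_False)
    qed
  qed
  have eq: "(\<Sum>k\<le>n * 2 ^ n + 1. \<integral>\<omega>. g z n k \<omega> powr \<alpha> * g z' n k \<omega> powr (1 - \<alpha>)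
      \<partial>restr_to_subalg P (F (real (k - 1) / 2 ^ n))) =
    (\<integral>\<omega>. z 0 \<omega> powr \<alpha> * z' 0 \<omega> powr (1 - \<alpha>) * indicator {\<omega>. T \<omega> = 0} \<omega> \<partial>restr_to_subalg P (F 0))
    + (\<integral>\<omega>. z (real n) \<omega> powr \<alpha> * z' (real n) \<omega> powr (1 - \<alpha>) * indicator {\<omega>. ennreal (real n) < T \<omega>} \<omega>
         \<partial>restr_to_subalg P (F (real n)))
    + (\<Sum>k = 1..n * 2 ^ n.
         let s = (real k - 1) / 2 ^ n;
             t = real k / 2 ^ n;
             D = {\<omega>. ennreal s < T \<omega> \<and> T \<omega> \<le> ennreal t}
         in \<integral>\<omega>. real_cond_exp P (F s) (\<lambda>\<omega>. z t \<omega> * indicator D \<omega>) \<omega> powr \<alpha>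
               * real_cond_exp P (F s) (\<lambda>\<omega>. z' t \<omega> * indicator D \<omega>) \<omega> powr (1 - \<alpha>)
              \<partial>restr_to_subalg P (F s))" (is "sum ?f _ = ?a + ?b + sum ?r _") for \<alpha> n
  proof -
    \<comment> \<open>Because \<open>0 powr a = 0\<close> for every \<open>a\<close>, both sides
      vanish off \<open>D\<close> whatever \<alpha> is.\<close>
    have ind: "(u * indicator D \<omega>) powr \<alpha> * (v * indicator D \<omega>) powr (1 - \<alpha>)
        = u powr \<alpha> * v powr (1 - \<alpha>) * indicator D \<omega>" for u v :: real and D :: "'a set" and \<omega>
      by (simp add: indicator_def)
    have "{..n * 2 ^ n + 1} = insert 0 (insert (n * 2 ^ n + 1) {1..n * 2 ^ n})" by auto
    then have "sum ?f {..n * 2 ^ n + 1} = ?f 0 + ?f (n * 2 ^ n + 1) + sum ?f {1..n * 2 ^ n}" by simp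
    moreover have "?f 0 = ?a"
    proof -
      have "?c n 0 = {\<omega>. T \<omega> = 0}" by (auto simp: dyadic_cell_def)
      then show ?thesis by (simp add: g_def ind)
    qed
    moreover have "?f (n * 2 ^ n + 1) = ?b"
    proof -
      have "?c n (n * 2 ^ n + 1) = {\<omega>. ennreal (real n) < T \<omega>}" by (auto simp: dyadic_cell_def)
      then show ?thesis by (simp add: g_def ind)
    qed
    moreover have "sum ?f {1..n * 2 ^ n} = sum ?r {1..n * 2 ^ n}"
    proof (rule sum.cong[OF refl])
      fix k assume k: "k \<in> {1..n * 2 ^ n}"
      then have s: "real (k - 1) = real k - 1" by (simp add: of_nat_diff)
      have "?c n k = {\<omega>. ennreal ((real k - 1) / 2 ^ n) < T \<omega> \<and> T \<omega> \<le> ennreal (real k / 2 ^ n)}"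
        using k by (auto simp: dyadic_cell_def s)
      then show "?f k = ?r k" using k by (simp add: g_def s Let_def)
    qed
    ultimately show ?thesis by simp
  qed
  show ?thesis
    unfolding Let_def[of "ac_part _ _"] eq[symmetric]
    by (rule ac_part_strict_past_eq_double_liminf[OF F T assms(5-9) dens[OF assms(6,7,12)] dens[OF assms(8,9,13)]])
qed

end
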